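(* Let $\Lambda$ be a finite abelian group. Each trivial noncommutative principal $\Lambda$-bundle $(A,\Lambda,\alpha)$ is a noncommutative principal $\Lambda$-bundle.
   Context: Algebras are associative and complex. For an algebra $A$, $\Gamma_A$ denotes the set of nonzero algebra homomorphisms $A\to\mathbb{C}$. A dynamical system $(A,\Lambda,\alpha)$ consists of a unital locally convex algebra $A$ and a group homomorphism $\alpha:\Lambda\to\mathrm{Aut}(A)$ inducing a continuous action. For $\chi\in\widehat{\Lambda}=\mathrm{Hom}(\Lambda,\mathbb{T})$, $A_\chi=\{a\in A:\alpha(\lambda)a=\chi(\lambda)a\ \forall\lambda\in\Lambda\}$. Trivial bundles: let $\{\lambda_1,\ldots,\lambda_k\}$ be a set of generators of $\Lambda$ of minimal cardinality, of orders $n_1,\ldots,n_k$, such that $\Lambda$ is the internal direct product of the cyclic subgroups $\langle\lambda_i\rangle$. Define $\widehat{\lambda}_i\in\widehat{\Lambda}$ by $\widehat{\lambda}_i(\lambda_i)=\exp(2\pi i/n_i)$ (imaginary unit in the exponent) and $\widehat{\lambda}_i(\lambda_j)=1$ for $j\neq i$. $(A,\Lambda,\alpha)$ is a trivial noncommutative principal $\Lambda$-bundle if there exists such a set of generators for which each $A_{\widehat{\lambda}_i}$ contains an invertible element $a_i$ with $a_i^{n_i}=1_A$. Smooth localization: for a unital locally convex algebra $A$ and $a\in A$, let $f_a\in C^\infty(\mathbb{R},A)$, $f_a(t)=1_A-ta$, where $C^\infty(\mathbb{R},A)$ carries the smooth compact-open topology, let $I_a$ be the closure of the two-sided ideal generated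 by $f_a$, and set $A_{\{a\}}:=C^\infty(\mathbb{R},A)/I_a$. Let $C_A$ be the center of $A$ and $C_A^\Lambda$ the fixed point algebra of the induced $\Lambda$-action on $C_A$. For $z\in C_A^\Lambda$, $\alpha_{\{z\}}(\lambda,[f]):=[\alpha(\lambda)\circ f]$ defines an action of $\Lambda$ on $A_{\{z\}}$, giving a dynamical system $(A_{\{z\}},\Lambda,\alpha_{\{z\}})$. A dynamical system $(A,\Lambda,\alpha)$ is a noncommutative principal $\Lambda$-bundle if for each $\chi\in\Gamma_{C_A^\Lambda}$ there exists $z\in C_A^\Lambda$ with $\chi(z)\neq0$ such that $(A_{\{z\}},\Lambda,\alpha_{\{z\}})$ is a trivial noncommutative principal $\Lambda$-bundle. *)

theory Defs
  imports
    "HOL-Analysis.Analysis"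
    "HOL-Algebra.Algebra"
    "HOL-Algebra.Algebraic_Closure_Type"
begin

section \<open>Unital locally convex algebras\<close>

text \<open>An algebra is a record with an explicit carrier, because the predicates below have to apply
  both to the given algebra and to its smooth localizations, which are quotients of function
  algebras.\<close>

record 'a lc_alg = "(complex, 'a) module" +
  topol :: "'a topology"

abbreviation complex_ring :: "complex ring" where
  "complex_ring \<equiv> ring_of_type_algebra"

definition convex_in :: "('a, 'b) lc_alg_scheme \<Rightarrow> 'a set \<Rightarrow> bool" where
  "convex_in A V \<longleftrightarrow>
     (\<forall>x\<in>V. \<forall>y\<in>V. \<forall>t::real. 0 \<le> t \<and> t \<le> 1 \<longrightarrow>
        complex_of_real (1 - t) \<odot>\<^bsub>A\<^esub> x \<oplus>\<^bsub>A\<^esub> complex_of_real t \<odot>\<^bsub>A\<^esub> y \<in> V)"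

text \<open>The convention is that locally convex spaces are Hausdorff and that the multiplication of a
  locally convex algebra is jointly continuous.\<close>

definition lc_algebra :: "('a, 'b) lc_alg_scheme \<Rightarrow> bool" where
  "lc_algebra A \<longleftrightarrow>
     ring A \<and> Module.module complex_ring A \<and>
     (\<forall>c. \<forall>x\<in>carrier A. \<forall>y\<in>carrier A.
        (c \<odot>\<^bsub>A\<^esub> x) \<otimes>\<^bsub>A\<^esub> y = c \<odot>\<^bsub>A\<^esub> (x \<otimes>\<^bsub>A\<^esub> y) \<and>
        x \<otimes>\<^bsub>A\<^esub> (c \<odot>\<^bsub>A\<^esub> y) = c \<odot>\<^bsub>A\<^esub> (x \<otimes>\<^bsub>A\<^esub> y)) \<and>
     topspace (topol A) = carrier A \<and>
     Hausdorff_space (topol A) \<and>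
     continuous_map (prod_topology (topol A) (topol A)) (topol A) (\<lambda>(x, y). x \<oplus>\<^bsub>A\<^esub> y) \<and>
     continuous_map (prod_topology euclidean (topol A)) (topol A) (\<lambda>(c, x). c \<odot>\<^bsub>A\<^esub> x) \<and>
     continuous_map (prod_topology (topol A) (topol A)) (topol A) (\<lambda>(x, y). x \<otimes>\<^bsub>A\<^esub> y) \<and>
     (\<forall>U. openin (topol A) U \<and> \<zero>\<^bsub>A\<^esub> \<in> U \<longrightarrow>
        (\<exists>V. openin (topol A) V \<and> \<zero>\<^bsub>A\<^esub> \<in> V \<and> V \<subseteq> U \<and> convex_in A V))"

definition alg_hom :: "('a, 'c) lc_alg_scheme \<Rightarrow> ('b, 'd) lc_alg_scheme \<Rightarrow> ('a \<Rightarrow> 'b) set" where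
  "alg_hom A B =
     {h \<in> ring_hom A B. \<forall>c. \<forall>x\<in>carrier A. h (c \<odot>\<^bsub>A\<^esub> x) = c \<odot>\<^bsub>B\<^esub> h x}"

definition alg_Aut :: "('a, 'b) lc_alg_scheme \<Rightarrow> ('a \<Rightarrow> 'a) monoid" where
  "alg_Aut A = BijGroup (carrier A) \<lparr>carrier := alg_hom A A \<inter> Bij (carrier A)\<rparr>"

text \<open>The nonzero algebra homomorphisms to the complex numbers; neither continuity nor
  preservation of the unit is required (the latter follows from being nonzero).\<close>

definition spectrum_of :: "('a, 'b) lc_alg_scheme \<Rightarrow> ('a \<Rightarrow> complex) set" where
  "spectrum_of A =
     {\<psi> \<in> extensional (carrier A).
        (\<forall>x\<in>carrier A. \<forall>y\<in>carrier A. \<psi> (x \<oplus>\<^bsub>A\<^esub> y) = \<psi> x + \<psi> y) \<and>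
        (\<forall>c. \<forall>x\<in>carrier A. \<psi> (c \<odot>\<^bsub>A\<^esub> x) = c * \<psi> x) \<and>
        (\<forall>x\<in>carrier A. \<forall>y\<in>carrier A. \<psi> (x \<otimes>\<^bsub>A\<^esub> y) = \<psi> x * \<psi> y) \<and>
        (\<exists>x\<in>carrier A. \<psi> x \<noteq> 0)}"

section \<open>Dynamical systems\<close>

text \<open>The acting group is finite in the application, hence carries the discrete topology.\<close>

definition dynamical_system ::
    "('a, 'b) lc_alg_scheme \<Rightarrow> ('g, 'h) monoid_scheme \<Rightarrow> ('g \<Rightarrow> 'a \<Rightarrow> 'a) \<Rightarrow> bool" where
  "dynamical_system A L \<alpha> \<longleftrightarrow>
     lc_algebra A \<and> group L \<and> \<alpha> \<in> hom L (alg_Aut A) \<and>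
     continuous_map (prod_topology (discrete_topology (carrier L)) (topol A)) (topol A)
       (\<lambda>(l, a). \<alpha> l a)"

definition circle_group :: "complex monoid" where
  "circle_group = \<lparr>carrier = {z. cmod z = 1}, monoid.mult = (*), one = 1\<rparr>"

definition dual_group_set :: "('g, 'h) monoid_scheme \<Rightarrow> ('g \<Rightarrow> complex) set" where
  "dual_group_set L = hom L circle_group \<inter> extensional (carrier L)"

definition isotypic ::
    "('a, 'b) lc_alg_scheme \<Rightarrow> ('g, 'h) monoid_scheme \<Rightarrow> ('g \<Rightarrow> 'a \<Rightarrow> 'a)
      \<Rightarrow> ('g \<Rightarrow> complex) \<Rightarrow> 'a set" where
  "isotypic A L \<alpha> \<psi> = {a \<in> carrier A. \<forall>l\<in>carrier L. \<alpha> l a = \<psi> l \<odot>\<^bsub>A\<^esub> a}"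

definition center_of :: "('a, 'b) lc_alg_scheme \<Rightarrow> 'a set" where
  "center_of A = {z \<in> carrier A. \<forall>a\<in>carrier A. z \<otimes>\<^bsub>A\<^esub> a = a \<otimes>\<^bsub>A\<^esub> z}"

definition fixed_center ::
    "('a, 'b) lc_alg_scheme \<Rightarrow> ('g, 'h) monoid_scheme \<Rightarrow> ('g \<Rightarrow> 'a \<Rightarrow> 'a)
      \<Rightarrow> ('a, 'b) lc_alg_scheme" where
  "fixed_center A L \<alpha> =
     (let Z = {z \<in> center_of A. \<forall>l\<in>carrier L. \<alpha> l z = z}
      in A\<lparr>carrier := Z, topol := subtopology (topol A) Z\<rparr>)"

section \<open>Trivial bundles\<close>

text \<open>\<open>S\<close> is the set \<open>{\<lambda>\<^sub>1, \<dots>, \<lambda>\<^sub>k}\<close>.\<close>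

definition internal_direct_product_of_cyclic :: "('g, 'h) monoid_scheme \<Rightarrow> 'g set \<Rightarrow> bool" where
  "internal_direct_product_of_cyclic L S \<longleftrightarrow>
     (\<lambda>h. finprod L h S) \<in> iso (product_group S (\<lambda>s. subgroup_generated L {s})) L"

definition admissible_generators :: "('g, 'h) monoid_scheme \<Rightarrow> 'g set \<Rightarrow> bool" where
  "admissible_generators L S \<longleftrightarrow>
     finite S \<and> S \<subseteq> carrier L \<and> generate L S = carrier L \<and>
     (\<forall>S'. finite S' \<and> S' \<subseteq> carrier L \<and> generate L S' = carrier L \<longrightarrow> card S \<le> card S') \<and>
     internal_direct_product_of_cyclic L S"

text \<open>The unique character with the prescribed values on the generators; existence and uniqueness
  are established in \<open>dual_generator_ex1\<close> below.\<close>

definition dual_generator :: "('g, 'h) monoid_scheme \<Rightarrow> 'g set \<Rightarrow> 'g \<Rightarrow> ('g \<Rightarrow> complex)" where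
  "dual_generator L S s =
     (THE \<psi>. \<psi> \<in> dual_group_set L \<and>
        \<psi> s = exp (2 * of_real pi * \<i> / of_nat (group.ord L s)) \<and>
        (\<forall>s'\<in>S - {s}. \<psi> s' = 1))"

lemma dual_group_set_eqI:
  fixes L (structure)
  assumes "group L" and "S \<subseteq> carrier L" and gen: "generate L S = carrier L"
    and \<phi>: "\<phi> \<in> dual_group_set L" and \<psi>: "\<psi> \<in> dual_group_set L" and eq: "\<And>u. u \<in> S \<Longrightarrow> \<phi> u = \<psi> u"
  shows "\<phi> = \<psi>"
proof (rule extensionalityI[of _ "carrier L"])
  interpret group L by fact
  show "\<phi> \<in> extensional (carrier L)" "\<psi> \<in> extensional (carrier L)"
    using \<phi> \<psi> by (auto simp: dual_group_set_def)
  have m: "\<eta> (x \<otimes> y) = \<eta> x * \<eta> y" and nz: "\<eta> x \<noteq> 0"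
    if "\<eta> \<in> dual_group_set L" "x \<in> carrier L" "y \<in> carrier L" for \<eta> x y
    using that by (auto simp: dual_group_set_def hom_def circle_group_def Pi_iff)
  have one: "\<eta> \<one> = 1" if "\<eta> \<in> dual_group_set L" for \<eta>
    using m[OF that one_closed one_closed] nz[OF that one_closed one_closed] by simp
  have i: "\<eta> (inv x) = inverse (\<eta> x)" if "\<eta> \<in> dual_group_set L" "x \<in> carrier L" for \<eta> x
    using m[OF that inv_closed[OF that(2)]] that one[OF that(1)] nz[OF that that(2)]
    by (simp add: inverse_unique)
  fix x assume "x \<in> carrier L"
  then have "x \<in> generate L S" by (simp add: gen)
  then show "\<phi> x = \<psi> x"
  proof induction
    case (inv h) then have "h \<in> carrier L" "\<phi> h = \<psi> h" using eq assms(2) by auto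
    then show ?case using i[OF \<phi>, of h] i[OF \<psi>, of h] by metis
  next
    case (eng h1 h2) then have "h1 \<in> carrier L" "h2 \<in> carrier L" using gen by auto
    then show ?case using m[OF \<phi>, of h1 h2] m[OF \<psi>, of h1 h2] eng.IH by metis
  qed (auto simp: one \<phi> \<psi> eq)
qed

lemma dual_generator_ex1:
  fixes L (structure)
  assumes "comm_group L" and fin: "finite (carrier L)" and adm: "admissible_generators L S" and s: "s \<in> S"
  shows "\<exists>!\<psi>. \<psi> \<in> dual_group_set L \<and>
        \<psi> s = exp (2 * of_real pi * \<i> / of_nat (group.ord L s)) \<and> (\<forall>s'\<in>S - {s}. \<psi> s' = 1)"
proof -
  interpret comm_group L by fact
  define n where "n = ord s"
  define e :: "int \<Rightarrow> complex" where "e = (\<lambda>k. exp (2 * of_real pi * \<i> * of_int k / of_nat n))"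
  define G where "G = (\<lambda>s. subgroup_generated L {s})"
  define F where "F = (\<lambda>h. finprod L h S)"
  from adm have SL: "S \<subseteq> carrier L" and finS: "finite S" and gen: "generate L S = carrier L"
    and iso: "F \<in> iso (product_group S G) L"
    by (auto simp: admissible_generators_def internal_direct_product_of_cyclic_def F_def G_def)
  have sL: "s \<in> carrier L" using s SL by auto
  have n0: "n > 0" using ord_ge_1[OF fin sL] n_def by simp
  have cG: "carrier (G u) = range (\<lambda>k::int. u [^] k)" if "u \<in> S" for u
    using that SL by (auto simp: G_def carrier_subgroup_generated_by_singleton)
  have e_add: "e (j + k) = e j * e k" for j k
    by (simp add: e_def distrib_left add_divide_distrib exp_add)
  have e_eq: "e j = e k" if "s [^] j = s [^] k" for j k :: int
  proof -
    have "int n dvd j - k"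
      using that[symmetric] int_pow_eq[OF sL, of k j] by (simp add: n_def)
    then obtain m where "j - k = int n * m" by (rule dvdE)
    then have m: "j = k + int n * m" by simp
    have "e (int n * m) = exp (2 * of_int m * of_real pi * \<i>)"
      using n0 by (simp add: e_def field_simps)
    also have "\<dots> = 1" using exp_integer_2pi[of "of_int m"] by simp
    finally show ?thesis by (simp add: m e_add)
  qed
  define ind where "ind = (\<lambda>x. SOME k::int. x = s [^] k)"
  have ind: "e (ind (s [^] k)) = e k" for k :: int
    using someI[of "\<lambda>j::int. s [^] k = s [^] j" k] by (intro e_eq) (simp add: ind_def)
  define D where "D = inv_into (carrier (product_group S G)) F"
  have bij: "bij_betw F (carrier (product_group S G)) (carrier L)" using iso by (simp add: iso_def)
  have D: "D g \<in> carrier (product_group S G)" "F (D g) = g" if "g \<in> carrier L" for g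
    using that bij unfolding D_def by (auto simp: bij_betw_def inv_into_into f_inv_into_f simp del: carrier_product_group)
  have DF: "D (F h) = h" if "h \<in> carrier (product_group S G)" for h
    using that bij unfolding D_def by (auto simp: bij_betw_def simp del: carrier_product_group)
  have grpG: "group (G u)" for u by (simp add: G_def)
  have grp: "group (product_group S G)" by (simp add: grpG)
  have Fhom: "F (x \<otimes>\<^bsub>product_group S G\<^esub> y) = F x \<otimes> F y"
    if "x \<in> carrier (product_group S G)" "y \<in> carrier (product_group S G)" for x y
    using iso that by (auto simp: iso_def hom_def simp del: carrier_product_group mult_product_group)
  have Dmult: "D (x \<otimes> y) = D x \<otimes>\<^bsub>product_group S G\<^esub> D y" if "x \<in> carrier L" "y \<in> carrier L" for x y
    using DF[OF monoid.m_closed[OF group.is_monoid[OF grp] D(1)[OF that(1)] D(1)[OF that(2)]]]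
      Fhom[OF D(1)[OF that(1)] D(1)[OF that(2)]] D(2)[OF that(1)] D(2)[OF that(2)] by metis
  have Dmem: "\<exists>k::int. D x s = s [^] k" if "x \<in> carrier L" for x
  proof -
    have "D x s \<in> carrier (G s)" using D(1)[OF that] s by auto
    then show ?thesis using cG[OF s] by auto
  qed
  have Dgen: "D u = (\<lambda>i\<in>S. if i = u then u else \<one>)" if u: "u \<in> S" for u
  proof -
    let ?h = "\<lambda>i\<in>S. if i = u then u else \<one>"
    have "u \<in> carrier (G u)" using cG[OF u] u SL by (auto intro!: image_eqI[of _ _ 1] simp: subsetD)
    moreover have "\<one> \<in> carrier (G i)" for i
      using group.is_monoid[OF grpG, THEN monoid.one_closed, of i] by (simp add: G_def)
    ultimately have h: "?h \<in> carrier (product_group S G)" by auto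
    have "F ?h = finprod L (\<lambda>i. if u = i then (\<lambda>_. u) i else \<one>) S"
      unfolding F_def by (rule finprod_cong') (use u SL in auto)
    also have "\<dots> = u" by (subst finprod_singleton) (use u SL finS in auto)
    finally show ?thesis using DF[OF h] by simp
  qed
  define \<psi> where "\<psi> = (\<lambda>x\<in>carrier L. e (ind (D x s)))"
  have \<psi>_props: "\<psi> \<in> dual_group_set L \<and> \<psi> s = exp (2 * of_real pi * \<i> / of_nat (ord s)) \<and> (\<forall>s'\<in>S - {s}. \<psi> s' = 1)"
  proof (intro conjI)
    have "\<psi> (x \<otimes> y) = \<psi> x * \<psi> y" if xy: "x \<in> carrier L" "y \<in> carrier L" for x y
    proof -
      obtain j k :: int where "D x s = s [^] j" "D y s = s [^] k" using Dmem xy by metis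
      moreover have "D (x \<otimes> y) s = D x s \<otimes> D y s" using Dmult[OF xy] s by (simp add: G_def)
      ultimately have "D (x \<otimes> y) s = s [^] (j + k)" using sL by (simp add: int_pow_mult)
      then show ?thesis using xy \<open>D x s = _\<close> \<open>D y s = _\<close> by (simp add: \<psi>_def ind e_add)
    qed
    moreover have "cmod (e k) = 1" for k by (simp add: e_def)
    ultimately show "\<psi> \<in> dual_group_set L"
      by (auto simp: dual_group_set_def hom_def circle_group_def \<psi>_def)
    have "D s s = s [^] (1::int)" using Dgen[OF s] s sL by simp
    then show "\<psi> s = exp (2 * of_real pi * \<i> / of_nat (ord s))"
      using sL ind[of 1] by (simp add: \<psi>_def e_def n_def del: int_pow_1)
    show "\<forall>s'\<in>S - {s}. \<psi> s' = 1"
    proof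
      fix u assume u: "u \<in> S - {s}"
      then have "D u s = s [^] (0::int)" using Dgen[of u] s sL by auto
      then show "\<psi> u = 1" using u SL ind[of 0] by (auto simp: \<psi>_def e_def simp del: int_pow_0)
    qed
  qed
  show ?thesis
  proof (rule ex1I[of _ \<psi>], rule \<psi>_props)
    fix \<phi> assume \<phi>: "\<phi> \<in> dual_group_set L \<and> \<phi> s = exp (2 * of_real pi * \<i> / of_nat (ord s)) \<and> (\<forall>s'\<in>S - {s}. \<phi> s' = 1)"
    show "\<phi> = \<psi>"
      using \<phi> \<psi>_props by (intro dual_group_set_eqI[OF is_group SL gen]) (blast, blast, metis DiffI singletonD)
  qed
qed

definition trivial_nc_principal_bundle ::
    "('a, 'b) lc_alg_scheme \<Rightarrow> ('g, 'h) monoid_scheme \<Rightarrow> ('g \<Rightarrow> 'a \<Rightarrow> 'a) \<Rightarrow> bool" where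
  "trivial_nc_principal_bundle A L \<alpha> \<longleftrightarrow>
     dynamical_system A L \<alpha> \<and>
     (\<exists>S. admissible_generators L S \<and>
        (\<forall>s\<in>S. \<exists>a \<in> isotypic A L \<alpha> (dual_generator L S s).
           a \<in> Units A \<and> a [^]\<^bsub>A\<^esub> group.ord L s = \<one>\<^bsub>A\<^esub>))"

section \<open>Smooth curves in a locally convex algebra\<close>

definition has_curve_derivative ::
    "('a, 'b) lc_alg_scheme \<Rightarrow> (real \<Rightarrow> 'a) \<Rightarrow> 'a \<Rightarrow> real \<Rightarrow> bool" where
  "has_curve_derivative A f d t \<longleftrightarrow>
     limitin (topol A) (\<lambda>h. complex_of_real (1 / h) \<odot>\<^bsub>A\<^esub> (f (t + h) \<ominus>\<^bsub>A\<^esub> f t)) d (at 0)"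

definition curve_deriv :: "('a, 'b) lc_alg_scheme \<Rightarrow> (real \<Rightarrow> 'a) \<Rightarrow> real \<Rightarrow> 'a" where
  "curve_deriv A f t = (THE d. has_curve_derivative A f d t)"

definition smooth_curves :: "('a, 'b) lc_alg_scheme \<Rightarrow> (real \<Rightarrow> 'a) set" where
  "smooth_curves A =
     {f. \<forall>n. continuous_map euclideanreal (topol A) ((curve_deriv A ^^ n) f) \<and>
             (\<forall>t. \<exists>d. has_curve_derivative A ((curve_deriv A ^^ n) f) d t)}"

text \<open>The coarsest topology for which every \<open>f \<mapsto> f\<^sup>(\<^sup>n\<^sup>)\<close> is continuous into the continuous
  curves with the compact-open topology. With \<open>K = {}\<close> the subbasis contains the whole space.\<close>

definition smooth_compact_open_topology :: "('a, 'b) lc_alg_scheme \<Rightarrow> (real \<Rightarrow> 'a) topology" where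
  "smooth_compact_open_topology A =
     topology_generated_by
       {{f \<in> smooth_curves A. (curve_deriv A ^^ n) f ` K \<subseteq> U} | n K U.
          compact K \<and> openin (topol A) U}"

definition smooth_curve_algebra :: "('a, 'b) lc_alg_scheme \<Rightarrow> (real \<Rightarrow> 'a) lc_alg" where
  "smooth_curve_algebra A =
     \<lparr>carrier = smooth_curves A,
      monoid.mult = (\<lambda>f g t. f t \<otimes>\<^bsub>A\<^esub> g t),
      monoid.one = (\<lambda>t. \<one>\<^bsub>A\<^esub>),
      ring.zero = (\<lambda>t. \<zero>\<^bsub>A\<^esub>),
      ring.add = (\<lambda>f g t. f t \<oplus>\<^bsub>A\<^esub> g t),
      module.smult = (\<lambda>c f t. c \<odot>\<^bsub>A\<^esub> f t),
      topol = smooth_compact_open_topology A\<rparr>"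

section \<open>Quotient algebras and smooth localization\<close>

definition quotient_topol :: "('a, 'b) lc_alg_scheme \<Rightarrow> 'a set \<Rightarrow> 'a set topology" where
  "quotient_topol A I =
     topology (\<lambda>W. W \<subseteq> carrier (A Quot I) \<and>
       openin (topol A) {x \<in> topspace (topol A). I +>\<^bsub>A\<^esub> x \<in> W})"

lemma openin_quotient_topol:
  "openin (quotient_topol A I) W \<longleftrightarrow>
     W \<subseteq> carrier (A Quot I) \<and> openin (topol A) {x \<in> topspace (topol A). I +>\<^bsub>A\<^esub> x \<in> W}"
proof -
  let ?P = "\<lambda>W. {x \<in> topspace (topol A). I +>\<^bsub>A\<^esub> x \<in> W}"
  have Int: "?P (V \<inter> W) = ?P V \<inter> ?P W" for V W
    by auto
  have Union: "?P (\<Union>\<K>) = (\<Union>W\<in>\<K>. ?P W)" for \<K>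
    by auto
  have "istopology (\<lambda>W. W \<subseteq> carrier (A Quot I) \<and> openin (topol A) (?P W))"
    unfolding istopology_def
  proof (intro conjI allI impI; (elim conjE)?)
    fix V W
    assume "V \<subseteq> carrier (A Quot I)" then show "V \<inter> W \<subseteq> carrier (A Quot I)" by blast
    assume "openin (topol A) (?P V)" "openin (topol A) (?P W)"
    then show "openin (topol A) (?P (V \<inter> W))" unfolding Int by (rule openin_Int)
  next
    fix \<K> assume *: "\<forall>W\<in>\<K>. W \<subseteq> carrier (A Quot I) \<and> openin (topol A) (?P W)"
    then show "\<Union>\<K> \<subseteq> carrier (A Quot I)" by blast
    show "openin (topol A) (?P (\<Union>\<K>))" unfolding Union by (rule openin_Union) (use * in blast)
  qed
  then show ?thesis
    by (simp add: quotient_topol_def topology_inverse')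
qed

definition quotient_algebra :: "('a, 'b) lc_alg_scheme \<Rightarrow> 'a set \<Rightarrow> 'a set lc_alg" where
  "quotient_algebra A I =
     \<lparr>carrier = carrier (A Quot I),
      monoid.mult = monoid.mult (A Quot I),
      monoid.one = \<one>\<^bsub>A Quot I\<^esub>,
      ring.zero = \<zero>\<^bsub>A Quot I\<^esub>,
      ring.add = ring.add (A Quot I),
      module.smult = (\<lambda>c Y. \<Union>x\<in>Y. I +>\<^bsub>A\<^esub> (c \<odot>\<^bsub>A\<^esub> x)),
      topol = quotient_topol A I\<rparr>"

definition localization_ideal :: "('a, 'b) lc_alg_scheme \<Rightarrow> 'a \<Rightarrow> (real \<Rightarrow> 'a) set" where
  "localization_ideal A a =
     smooth_compact_open_topology A closure_of
       genideal (smooth_curve_algebra A)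
         {\<lambda>t. \<one>\<^bsub>A\<^esub> \<ominus>\<^bsub>A\<^esub> complex_of_real t \<odot>\<^bsub>A\<^esub> a}"

definition smooth_localization :: "('a, 'b) lc_alg_scheme \<Rightarrow> 'a \<Rightarrow> (real \<Rightarrow> 'a) set lc_alg" where
  "smooth_localization A a = quotient_algebra (smooth_curve_algebra A) (localization_ideal A a)"

text \<open>\<open>[f] \<mapsto> [\<alpha>(\<lambda>) \<circ> f]\<close>, where the union runs over all representatives \<open>f\<close> of the class \<open>Y\<close>; for a
  well-defined action all members of the union coincide.\<close>

definition localized_action ::
    "('a, 'b) lc_alg_scheme \<Rightarrow> ('g \<Rightarrow> 'a \<Rightarrow> 'a) \<Rightarrow> 'a
      \<Rightarrow> 'g \<Rightarrow> (real \<Rightarrow> 'a) set \<Rightarrow> (real \<Rightarrow> 'a) set" where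
  "localized_action A \<alpha> z l =
     (\<lambda>Y \<in> carrier (smooth_localization A z).
        \<Union>f\<in>Y. localization_ideal A z +>\<^bsub>smooth_curve_algebra A\<^esub> (\<alpha> l \<circ> f))"

section \<open>Noncommutative principal bundles\<close>

definition nc_principal_bundle ::
    "('a, 'b) lc_alg_scheme \<Rightarrow> ('g, 'h) monoid_scheme \<Rightarrow> ('g \<Rightarrow> 'a \<Rightarrow> 'a) \<Rightarrow> bool" where
  "nc_principal_bundle A L \<alpha> \<longleftrightarrow>
     dynamical_system A L \<alpha> \<and>
     (\<forall>\<psi> \<in> spectrum_of (fixed_center A L \<alpha>).
        \<exists>z \<in> carrier (fixed_center A L \<alpha>).
          \<psi> z \<noteq> 0 \<and>
          trivial_nc_principal_bundle (smooth_localization A z) L (localized_action A \<alpha> z))"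

end

theory Submission
  imports Defs
begin

text \<open>Take \<open>z = 1\<close>, which every character maps to a nonzero number. The constant curves give a unital
  homomorphism \<open>A \<rightarrow> C\<^sup>\<infinity>(\<real>, A) \<rightarrow> A\<^sub>z\<close> that intertwines the actions, so it carries an invertible
  \<open>n\<close>-th root of \<open>1\<close> in an isotypic component of \<open>A\<close> to one in the corresponding component of
  \<open>A\<^sub>z\<close>. What remains is that \<open>A\<^sub>z\<close> is a dynamical system at all: \<open>C\<^sup>\<infinity>(\<real>, A)\<close> is a locally
  convex algebra, so is its quotient by a closed ideal, and the ideal is invariant because \<open>z\<close> is
  fixed by the action.\<close>

section \<open>Calculus of curves in a locally convex algebra\<close>

text \<open>Both topologies to be handled are indirect: the one on curves is given by a subbasis
  speaking of all iterated derivatives, the one on the localization by preimages under the coset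
  map. No seminorms are introduced. Continuity into the curve algebra is exchanged for joint
  continuity in parameter and time, and families of curves closed under differentiation take the
  place of formulas for n-th derivatives. On the quotient, joint continuity of the operations has to
  descend along a product of two maps; a product of quotient maps need not be a quotient map, so the
  argument goes through openness of the coset map. The closure taken in
  \<open>localization_ideal\<close> is what makes the quotient Hausdorff.

  The same generating set serves \<open>A\<close> and its localization, because
  \<open>admissible_generators\<close> and \<open>dual_generator\<close> refer to \<open>L\<close>
  alone. The transfer is proved at every invariant z; the unit is chosen because it is central, is
  fixed by unital automorphisms, and is not killed by any character.\<close>

locale lc_alg = fixes A :: "('a, 'b) lc_alg_scheme" (structure)
  assumes lc_algebra: "lc_algebra A"
begin

sublocale ring A
  using lc_algebra by (simp add: lc_algebra_def)

lemma is_module: "Module.module complex_ring A"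
  using lc_algebra by (simp add: lc_algebra_def)

lemma smult_closed [simp, intro]: "x \<in> carrier A \<Longrightarrow> c \<odot> x \<in> carrier A"
  using module.smult_closed[OF is_module, of c x] by (simp add: ring_of_type_algebra_def)

lemma smult_l_distr: "x \<in> carrier A \<Longrightarrow> (c + d) \<odot> x = c \<odot> x \<oplus> d \<odot> x"
  using module.smult_l_distr[OF is_module, of c d x] by (simp add: ring_of_type_algebra_def)

lemma smult_r_distr:
  "x \<in> carrier A \<Longrightarrow> y \<in> carrier A \<Longrightarrow> c \<odot> (x \<oplus> y) = c \<odot> x \<oplus> c \<odot> y"
  using module.smult_r_distr[OF is_module, of c x y] by (simp add: ring_of_type_algebra_def)

lemma smult_assoc1: "x \<in> carrier A \<Longrightarrow> (c * d) \<odot> x = c \<odot> (d \<odot> x)"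
  using module.smult_assoc1[OF is_module, of c d x] by (simp add: ring_of_type_algebra_def)

lemma smult_one [simp]: "x \<in> carrier A \<Longrightarrow> 1 \<odot> x = x"
  using module.smult_one[OF is_module, of x] by (simp add: ring_of_type_algebra_def)

lemma smult_mult_left:
  "x \<in> carrier A \<Longrightarrow> y \<in> carrier A \<Longrightarrow> (c \<odot> x) \<otimes> y = c \<odot> (x \<otimes> y)"
  using lc_algebra by (simp add: lc_algebra_def)

lemma smult_mult_right:
  "x \<in> carrier A \<Longrightarrow> y \<in> carrier A \<Longrightarrow> x \<otimes> (c \<odot> y) = c \<odot> (x \<otimes> y)"
  using lc_algebra by (simp add: lc_algebra_def)

lemma smult_zero_left [simp]: "x \<in> carrier A \<Longrightarrow> 0 \<odot> x = \<zero>"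
  using smult_l_distr[of x 0 0] by (metis add.l_cancel_one' add_0 smult_closed)

lemma smult_zero_right [simp]: "c \<odot> \<zero> = \<zero>"
  using smult_r_distr[of \<zero> \<zero> c] by (metis add.l_cancel_one' smult_closed l_zero zero_closed)

lemma smult_minus_one: "x \<in> carrier A \<Longrightarrow> (-1) \<odot> x = \<ominus> x"
  using smult_l_distr[of x "-1" 1] by (metis add.left_inverse add.inv_equality smult_closed smult_one smult_zero_left)

lemma smult_minus: "x \<in> carrier A \<Longrightarrow> c \<odot> (\<ominus> x) = \<ominus> (c \<odot> x)"
  by (metis mult.commute smult_assoc1 smult_closed smult_minus_one)

lemma smult_diff:
  "x \<in> carrier A \<Longrightarrow> y \<in> carrier A \<Longrightarrow> c \<odot> (x \<ominus> y) = c \<odot> x \<ominus> c \<odot> y"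
  by (simp add: minus_eq smult_r_distr smult_minus)

section \<open>Continuity and limits of the algebra operations\<close>

lemma topspace_topol [simp]: "topspace (topol A) = carrier A"
  using lc_algebra by (simp add: lc_algebra_def)

lemma Hausdorff: "Hausdorff_space (topol A)"
  using lc_algebra by (simp add: lc_algebra_def)

lemma convex_nhd:
  assumes "openin (topol A) U" "\<zero> \<in> U"
  obtains V where "openin (topol A) V" "\<zero> \<in> V" "V \<subseteq> U" "convex_in A V"
  using lc_algebra assms unfolding lc_algebra_def by meson

lemma continuous_map_carrier: "continuous_map T (topol A) f \<Longrightarrow> x \<in> topspace T \<Longrightarrow> f x \<in> carrier A"
  using continuous_map_image_subset_topspace[of T "topol A" f] by auto

lemma continuous_map_alg_add:
  assumes "continuous_map T (topol A) f" "continuous_map T (topol A) g"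
  shows "continuous_map T (topol A) (\<lambda>x. f x \<oplus> g x)"
proof -
  have "continuous_map (prod_topology (topol A) (topol A)) (topol A) (\<lambda>(x, y). x \<oplus> y)"
    using lc_algebra by (simp add: lc_algebra_def)
  from continuous_map_compose[OF continuous_map_pairedI[OF assms] this]
  show ?thesis by (simp add: o_def)
qed

lemma continuous_map_alg_mult:
  assumes "continuous_map T (topol A) f" "continuous_map T (topol A) g"
  shows "continuous_map T (topol A) (\<lambda>x. f x \<otimes> g x)"
proof -
  have "continuous_map (prod_topology (topol A) (topol A)) (topol A) (\<lambda>(x, y). x \<otimes> y)"
    using lc_algebra by (simp add: lc_algebra_def)
  from continuous_map_compose[OF continuous_map_pairedI[OF assms] this]
  show ?thesis by (simp add: o_def)
qed

lemma continuous_map_alg_smult: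
  assumes "continuous_map T euclidean c" "continuous_map T (topol A) g"
  shows "continuous_map T (topol A) (\<lambda>x. c x \<odot> g x)"
proof -
  have "continuous_map (prod_topology euclidean (topol A)) (topol A) (\<lambda>(c, y). c \<odot> y)"
    using lc_algebra by (simp add: lc_algebra_def)
  from continuous_map_compose[OF continuous_map_pairedI[OF assms] this]
  show ?thesis by (simp add: o_def)
qed

text \<open>\<open>lc_algebra\<close> postulates continuity of addition and of scalar multiplication
  but does not mention negation; subtraction is therefore expressed with the scalar -1.\<close>

lemma continuous_map_alg_diff:
  assumes "continuous_map T (topol A) f" "continuous_map T (topol A) g"
  shows "continuous_map T (topol A) (\<lambda>x. f x \<ominus> g x)"
proof -
  have "continuous_map T (topol A) (\<lambda>x. f x \<oplus> (-1) \<odot> g x)"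
    by (intro continuous_map_alg_add continuous_map_alg_smult assms) auto
  then show ?thesis
    by (rule continuous_map_eq)
      (use assms in \<open>simp add: minus_eq smult_minus_one continuous_map_carrier\<close>)
qed

lemma limitin_alg_add:
  assumes "limitin (topol A) f x F" "limitin (topol A) g y F"
  shows "limitin (topol A) (\<lambda>h. f h \<oplus> g h) (x \<oplus> y) F"
proof -
  have c: "continuous_map (prod_topology (topol A) (topol A)) (topol A) (\<lambda>(x, y). x \<oplus> y)"
    using lc_algebra by (simp add: lc_algebra_def)
  have "limitin (prod_topology (topol A) (topol A)) (\<lambda>h. (f h, g h)) (x, y) F"
    using assms by (simp add: limitin_pairwise o_def)
  from continuous_map_limit[OF c this] show ?thesis by (simp add: o_def)
qed

lemma limitin_alg_mult:
  assumes "limitin (topol A) f x F" "limitin (topol A) g y F"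
  shows "limitin (topol A) (\<lambda>h. f h \<otimes> g h) (x \<otimes> y) F"
proof -
  have c: "continuous_map (prod_topology (topol A) (topol A)) (topol A) (\<lambda>(x, y). x \<otimes> y)"
    using lc_algebra by (simp add: lc_algebra_def)
  have "limitin (prod_topology (topol A) (topol A)) (\<lambda>h. (f h, g h)) (x, y) F"
    using assms by (simp add: limitin_pairwise o_def)
  from continuous_map_limit[OF c this] show ?thesis by (simp add: o_def)
qed

lemma limitin_alg_smult:
  assumes "limitin (topol A) g y F"
  shows "limitin (topol A) (\<lambda>h. c \<odot> g h) (c \<odot> y) F"
proof -
  have "continuous_map (topol A) (topol A) (\<lambda>y. c \<odot> y)"
    using continuous_map_alg_smult[of "topol A" "\<lambda>_. c" "\<lambda>y. y"] by simp
  from continuous_map_limit[OF this assms] show ?thesis by (simp add: o_def)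
qed

section \<open>Derivatives of curves: uniqueness and the differentiation rules\<close>

lemma has_curve_derivative_unique:
  "has_curve_derivative A f d t \<Longrightarrow> has_curve_derivative A f d' t \<Longrightarrow> d = d'"
  unfolding has_curve_derivative_def
  using limitin_Hausdorff_unique[OF _ _ _ Hausdorff] by (meson at_neq_bot)

text \<open>Limits in a Hausdorff space are unique, so the \<open>THE\<close> in
  \<open>curve_deriv\<close> denotes the derivative whenever there is one. From here on derivatives
  are computed by exhibiting them.\<close>

lemma curve_deriv_eq: "has_curve_derivative A f d t \<Longrightarrow> curve_deriv A f t = d"
  unfolding curve_deriv_def using has_curve_derivative_unique by blast

lemma curve_deriv_eqI: "(\<And>t. has_curve_derivative A f (g t) t) \<Longrightarrow> curve_deriv A f = g"
  using curve_deriv_eq by blast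

lemma has_curve_derivative_add:
  assumes "has_curve_derivative A f d t" "has_curve_derivative A g e t"
    and "range f \<subseteq> carrier A" "range g \<subseteq> carrier A"
  shows "has_curve_derivative A (\<lambda>t. f t \<oplus> g t) (d \<oplus> e) t"
proof -
  have car: "f t \<in> carrier A" "g t \<in> carrier A" for t using assms by auto
  have "c \<odot> (f (t + h) \<ominus> f t) \<oplus> c \<odot> (g (t + h) \<ominus> g t)
      = c \<odot> ((f (t + h) \<oplus> g (t + h)) \<ominus> (f t \<oplus> g t))" for c h
  proof -
    have "(f (t + h) \<oplus> g (t + h)) \<ominus> (f t \<oplus> g t) = (f (t + h) \<ominus> f t) \<oplus> (g (t + h) \<ominus> g t)"
      using car by (simp add: minus_eq minus_add a_ac)
    then show ?thesis using car by (simp add: smult_r_distr)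
  qed
  then show ?thesis
    using limitin_alg_add[OF assms(1,2)[unfolded has_curve_derivative_def]]
    by (simp add: has_curve_derivative_def)
qed

lemma has_curve_derivative_smult:
  assumes "has_curve_derivative A f d t" and "range f \<subseteq> carrier A"
  shows "has_curve_derivative A (\<lambda>t. c \<odot> f t) (c \<odot> d) t"
proof -
  have car: "f t \<in> carrier A" for t using assms by auto
  have "c \<odot> (e \<odot> (f (t + h) \<ominus> f t)) = e \<odot> (c \<odot> f (t + h) \<ominus> c \<odot> f t)" for e h
    using car by (simp add: smult_diff[symmetric] smult_assoc1[symmetric] mult.commute)
  then show ?thesis
    using limitin_alg_smult[OF assms(1)[unfolded has_curve_derivative_def], of c]
    by (simp add: has_curve_derivative_def)
qed

text \<open>The increment of the product is split asymmetrically, with \<open>g\<close> evaluated at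
  t + h in one summand and \<open>f\<close> at t in the other. This is why continuity is asked of
  \<open>g\<close>, while \<open>f\<close> only has to stay in the carrier.\<close>

lemma has_curve_derivative_mult:
  assumes "has_curve_derivative A f d t" "has_curve_derivative A g e t"
    and "range f \<subseteq> carrier A" "continuous_map euclideanreal (topol A) g"
  shows "has_curve_derivative A (\<lambda>t. f t \<otimes> g t) (d \<otimes> g t \<oplus> f t \<otimes> e) t"
proof -
  have car: "f t \<in> carrier A" "g t \<in> carrier A" for t
    using assms by (auto intro: continuous_map_carrier)
  have "tendsto (\<lambda>h. t + h) t (at 0)"
    using tendsto_add[OF tendsto_const[of t "at 0"] tendsto_ident_at[of 0 UNIV]] by simp
  then have "limitin euclideanreal (\<lambda>h. t + h) t (at 0)" by simp
  from continuous_map_limit[OF assms(4) this]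
  have g: "limitin (topol A) (\<lambda>h. g (t + h)) (g t) (at 0)" by (simp add: o_def)
  have f: "limitin (topol A) (\<lambda>h. f t) (f t) (at 0)" using car by simp
  have "(c \<odot> (f (t + h) \<ominus> f t)) \<otimes> g (t + h) \<oplus> f t \<otimes> (c \<odot> (g (t + h) \<ominus> g t))
      = c \<odot> (f (t + h) \<otimes> g (t + h) \<ominus> f t \<otimes> g t)" for c h
  proof -
    have "f (t + h) \<otimes> g (t + h) \<ominus> f t \<otimes> g t
        = (f (t + h) \<ominus> f t) \<otimes> g (t + h) \<oplus> f t \<otimes> (g (t + h) \<ominus> g t)"
      using car[of "t + h"] car[of t] by algebra
    then show ?thesis
      using car by (simp add: smult_r_distr smult_mult_left smult_mult_right)
  qed
  then show ?thesis
    using limitin_alg_add[OF limitin_alg_mult[OF assms(1)[unfolded has_curve_derivative_def] g]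
        limitin_alg_mult[OF f assms(2)[unfolded has_curve_derivative_def]]]
    by (simp add: has_curve_derivative_def)
qed

lemma has_curve_derivative_const:
  assumes "a \<in> carrier A"
  shows "has_curve_derivative A (\<lambda>_. a) \<zero> t"
  using assms by (simp add: has_curve_derivative_def r_neg minus_eq)

lemma has_curve_derivative_linear:
  assumes "a \<in> carrier A"
  shows "has_curve_derivative A (\<lambda>t. complex_of_real t \<odot> a) a t"
proof -
  have "complex_of_real (1 / h) \<odot> (complex_of_real (t + h) \<odot> a \<ominus> complex_of_real t \<odot> a) = a"
    if "h \<noteq> 0" for h
  proof -
    have "complex_of_real (t + h) \<odot> a \<ominus> complex_of_real t \<odot> a = complex_of_real h \<odot> a"
      using assms by (simp add: smult_l_distr minus_eq a_ac r_neg r_neg1 r_neg2)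
    then show ?thesis
      using that assms by (simp add: smult_assoc1[symmetric])
  qed
  \<comment> \<open>The filter \<open>at 0\<close> leaves out h = 0, where 1 / h is 0 by convention
    and the quotient would be zero instead of \<open>a\<close>.\<close>
  then have "eventually (\<lambda>h. complex_of_real (1 / h) \<odot>
      (complex_of_real (t + h) \<odot> a \<ominus> complex_of_real t \<odot> a) = a) (at 0)"
    by (simp add: eventually_at_filter)
  then show ?thesis
    unfolding has_curve_derivative_def
    by (intro limitin_eventually) (use assms in \<open>auto elim: eventually_mono\<close>)
qed

end

section \<open>Continuity in the smooth compact-open topology\<close>

lemma continuous_map_fst_fst:
  "continuous_map (prod_topology (prod_topology T U) V) T (\<lambda>x. fst (fst x))"
  using continuous_map_fst_of[OF continuous_map_fst] by (simp add: o_def)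

lemma continuous_map_snd_fst:
  "continuous_map (prod_topology (prod_topology T U) V) U (\<lambda>x. snd (fst x))"
  using continuous_map_snd_of[OF continuous_map_fst] by (simp add: o_def)

context lc_alg
begin

lemma topspace_smooth [simp]: "topspace (smooth_compact_open_topology A) = smooth_curves A"
proof -
  have "{f \<in> smooth_curves A. (curve_deriv A ^^ 0) f ` {} \<subseteq> {}}
      \<in> {{f \<in> smooth_curves A. (curve_deriv A ^^ n) f ` K \<subseteq> U} | n K U.
          compact K \<and> openin (topol A) U}"
    by blast
  then show ?thesis
    unfolding smooth_compact_open_topology_def topology_generated_by_topspace by fastforce
qed

lemma openin_smooth_subbasis:
  "compact K \<Longrightarrow> openin (topol A) U \<Longrightarrow>
    openin (smooth_compact_open_topology A) {f \<in> smooth_curves A. (curve_deriv A ^^ n) f ` K \<subseteq> U}"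
  unfolding smooth_compact_open_topology_def by (rule topology_generated_by_Basis) blast

text \<open>The definition of \<open>smooth_curves\<close> only asserts that each iterate has some
  derivative; uniqueness identifies it with the next iterate, which is the form that the
  differentiation rules consume.\<close>

lemma smooth_curves_funpow:
  assumes "f \<in> smooth_curves A"
  shows "continuous_map euclideanreal (topol A) ((curve_deriv A ^^ n) f)"
    and "has_curve_derivative A ((curve_deriv A ^^ n) f) ((curve_deriv A ^^ Suc n) f t) t"
    and "(curve_deriv A ^^ n) f t \<in> carrier A"
proof -
  show c: "continuous_map euclideanreal (topol A) ((curve_deriv A ^^ n) f)"
    using assms by (simp add: smooth_curves_def)
  obtain d where d: "has_curve_derivative A ((curve_deriv A ^^ n) f) d t"
    using assms unfolding smooth_curves_def by blast
  with curve_deriv_eq[OF d]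
  show "has_curve_derivative A ((curve_deriv A ^^ n) f) ((curve_deriv A ^^ Suc n) f t) t"
    by simp
  show "(curve_deriv A ^^ n) f t \<in> carrier A"
    using continuous_map_carrier[OF c] by simp
qed

lemma smooth_curves_carrier: "f \<in> smooth_curves A \<Longrightarrow> f t \<in> carrier A"
  using smooth_curves_funpow(3)[of f 0] by simp

text \<open>Since \<open>\<real>\<close> is locally compact, continuity into the smooth
  compact-open topology amounts to joint continuity of all derivatives in the parameter and the
  time variable.\<close>

lemma continuous_map_smooth_coinduct:
  fixes T :: "'p topology" and \<Phi> :: "('p \<Rightarrow> real \<Rightarrow> 'a) set"
  assumes cont: "\<And>\<phi>. \<phi> \<in> \<Phi> \<Longrightarrow>
      continuous_map (prod_topology T euclideanreal) (topol A) (\<lambda>x. \<phi> (fst x) (snd x))"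
    and der: "\<And>\<phi>. \<phi> \<in> \<Phi> \<Longrightarrow>
      \<exists>\<phi>'\<in>\<Phi>. \<forall>p\<in>topspace T. \<forall>t. has_curve_derivative A (\<phi> p) (\<phi>' p t) t"
    and \<phi>: "\<phi> \<in> \<Phi>"
  shows "continuous_map T (smooth_compact_open_topology A) \<phi>"
proof -
  \<comment> \<open>Closure under differentiation, with one member of \<open>\<Phi>\<close> valid
    for all parameters at once, keeps every iterated derivative of \<open>\<phi>\<close> inside the
    family.\<close>
  have funpow: "\<exists>\<phi>'\<in>\<Phi>. \<forall>p\<in>topspace T. (curve_deriv A ^^ n) (\<phi> p) = \<phi>' p" for n
  proof (induction n)
    case 0 show ?case using \<phi> by auto
  next
    case (Suc n)
    then obtain \<phi>1 where 1: "\<phi>1 \<in> \<Phi>" "\<And>p. p \<in> topspace T \<Longrightarrow> (curve_deriv A ^^ n) (\<phi> p) = \<phi>1 p"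
      by blast
    from der[OF 1(1)] obtain \<phi>2 where "\<phi>2 \<in> \<Phi>"
      "\<And>p t. p \<in> topspace T \<Longrightarrow> has_curve_derivative A (\<phi>1 p) (\<phi>2 p t) t" by blast
    with 1 curve_deriv_eqI show ?case by (intro bexI[of _ \<phi>2]) auto
  qed
  have slice: "continuous_map euclideanreal (topol A) (\<phi>' p)" if "\<phi>' \<in> \<Phi>" "p \<in> topspace T" for \<phi>' p
  proof -
    have "continuous_map euclideanreal (prod_topology T euclideanreal) (\<lambda>t. (p, t))"
      using that by (intro continuous_map_pairedI) auto
    from continuous_map_compose[OF this cont[OF that(1)]] show ?thesis by (simp add: o_def)
  qed
  have smooth: "\<phi> p \<in> smooth_curves A" if p: "p \<in> topspace T" for p
    unfolding smooth_curves_def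
  proof (intro CollectI allI)
    fix n
    obtain \<phi>' where \<phi>': "\<phi>' \<in> \<Phi>" "(curve_deriv A ^^ n) (\<phi> p) = \<phi>' p" using funpow p by blast
    then show "continuous_map euclideanreal (topol A) ((curve_deriv A ^^ n) (\<phi> p)) \<and>
        (\<forall>t. \<exists>d. has_curve_derivative A ((curve_deriv A ^^ n) (\<phi> p)) d t)"
      using slice[OF \<phi>'(1) p] der[OF \<phi>'(1)] p by auto
  qed
  have op: "openin T (\<phi> -` {f \<in> smooth_curves A. (curve_deriv A ^^ n) f ` K \<subseteq> U} \<inter> topspace T)"
    (is "openin T ?P") if K: "compact K" and U: "openin (topol A) U" for n K U
  proof -
    obtain \<phi>' where \<phi>': "\<phi>' \<in> \<Phi>" "\<And>p. p \<in> topspace T \<Longrightarrow> (curve_deriv A ^^ n) (\<phi> p) = \<phi>' p"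
      using funpow by blast
    define W where "W = {x \<in> topspace (prod_topology T euclideanreal). \<phi>' (fst x) (snd x) \<in> U}"
    have W: "openin (prod_topology T euclideanreal) W"
      unfolding W_def by (rule openin_continuous_map_preimage[OF cont[OF \<phi>'(1)] U])
    \<comment> \<open>The subbasic condition at \<open>p\<close> says that the slice {p} x K lies in
      the open set \<open>W\<close>. As K is compact, the tube lemma thickens the slice to a whole
      neighbourhood of \<open>p\<close>.\<close>
    have "\<exists>V. openin T V \<and> p \<in> V \<and> V \<subseteq> ?P" if "p \<in> ?P" for p
    proof -
      have p: "p \<in> topspace T" "\<phi>' p ` K \<subseteq> U" using that \<phi>'(2) by auto
      then have "{p} \<times> K \<subseteq> W" by (auto simp: W_def)
      moreover have "compactin euclideanreal K" using K by simp
      ultimately obtain V1 V2 where V: "openin T V1" "p \<in> V1" "K \<subseteq> V2" "V1 \<times> V2 \<subseteq> W"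
        using tube_lemma_right[OF W _ p(1)] by metis
      have "V1 \<subseteq> ?P"
      proof
        fix q assume q: "q \<in> V1"
        then have "q \<in> topspace T" using openin_subset[OF V(1)] by auto
        moreover have "\<phi>' q ` K \<subseteq> U" using q V(3,4) unfolding W_def by fastforce
        ultimately show "q \<in> ?P" using smooth \<phi>'(2) by auto
      qed
      then show ?thesis using V by blast
    qed
    then show ?thesis by (subst openin_subopen) blast
  qed
  show ?thesis
    unfolding smooth_compact_open_topology_def
  proof (rule continuous_on_generated_topo)
    fix V assume "V \<in> {{f \<in> smooth_curves A. (curve_deriv A ^^ n) f ` K \<subseteq> U} | n K U.
          compact K \<and> openin (topol A) U}"
    then show "openin T (\<phi> -` V \<inter> topspace T)" using op by blast
  next
    show "\<phi> ` topspace T \<subseteq> \<Union> {{f \<in> smooth_curves A. (curve_deriv A ^^ n) f ` K \<subseteq> U} | n K U.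
          compact K \<and> openin (topol A) U}"
      using smooth topspace_smooth
      unfolding smooth_compact_open_topology_def topology_generated_by_topspace by blast
  qed
qed

text \<open>Local compactness of the real line enters here: a closed ball around t is mapped into
  \<open>U\<close> by the n-th derivative, and it is compact, so it may serve as the K of a subbasic
  neighbourhood. This lemma supplies the joint continuity that the coinduction principle asks
  for.\<close>

lemma continuous_map_smooth_eval:
  "continuous_map (prod_topology (smooth_compact_open_topology A) euclideanreal) (topol A)
     (\<lambda>x. (curve_deriv A ^^ n) (fst x) (snd x))"
  unfolding continuous_map_def
proof (intro conjI allI impI)
  show "(\<lambda>x. (curve_deriv A ^^ n) (fst x) (snd x))
      \<in> topspace (prod_topology (smooth_compact_open_topology A) euclideanreal) \<rightarrow> topspace (topol A)"
    by (auto intro: smooth_curves_funpow(3))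
  fix U assume U: "openin (topol A) U"
  let ?P = "{x \<in> topspace (prod_topology (smooth_compact_open_topology A) euclideanreal).
      (curve_deriv A ^^ n) (fst x) (snd x) \<in> U}"
  have "\<exists>V W. openin (smooth_compact_open_topology A) V \<and> openin euclideanreal W \<and> f \<in> V \<and> t \<in> W
      \<and> V \<times> W \<subseteq> ?P"
    if "(f, t) \<in> ?P" for f t
  proof -
    have f: "f \<in> smooth_curves A" and ft: "(curve_deriv A ^^ n) f t \<in> U" using that by auto
    have "openin euclideanreal {s \<in> topspace euclideanreal. (curve_deriv A ^^ n) f s \<in> U}"
      by (rule openin_continuous_map_preimage[OF smooth_curves_funpow(1)[OF f] U])
    then have "open {s. (curve_deriv A ^^ n) f s \<in> U}" by simp
    then obtain e where e: "e > 0" "cball t e \<subseteq> {s. (curve_deriv A ^^ n) f s \<in> U}"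
      using ft open_contains_cball by blast
    show ?thesis
    proof (intro exI conjI)
      show "openin (smooth_compact_open_topology A)
          {g \<in> smooth_curves A. (curve_deriv A ^^ n) g ` cball t e \<subseteq> U}"
        by (intro openin_smooth_subbasis U) auto
      show "openin euclideanreal (ball t e)" by simp
    qed (use e f in \<open>auto simp: image_subset_iff\<close>)
  qed
  then show "openin (prod_topology (smooth_compact_open_topology A) euclideanreal) ?P"
    unfolding openin_prod_topology_alt by blast
qed

lemma continuous_map_smooth_eval_of:
  assumes "continuous_map T (smooth_compact_open_topology A) f" "continuous_map T euclideanreal t"
  shows "continuous_map T (topol A) (\<lambda>x. (curve_deriv A ^^ n) (f x) (t x))"
  using continuous_map_compose[OF continuous_map_pairedI[OF assms] continuous_map_smooth_eval[of n]]
  by (simp add: o_def)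

section \<open>Continuity of the pointwise operations on smooth curves\<close>

lemma continuous_map_smooth_add:
  "continuous_map (prod_topology (smooth_compact_open_topology A) (smooth_compact_open_topology A))
     (smooth_compact_open_topology A) (\<lambda>p t. fst p t \<oplus> snd p t)"
proof (rule continuous_map_smooth_coinduct)
  \<comment> \<open>Member n is what n differentiations of the sum yield, so differentiating shifts
    n to \<open>Suc n\<close>. The families for scalar multiples and for composition with a
    homomorphism are built in the same way.\<close>
  let ?\<Phi> = "range (\<lambda>n p t. (curve_deriv A ^^ n) (fst p) t \<oplus> (curve_deriv A ^^ n) (snd p) t)"
  show "(\<lambda>p t. fst p t \<oplus> snd p t) \<in> ?\<Phi>" by (rule range_eqI[of _ _ 0]) simp
  fix \<phi> assume "\<phi> \<in> ?\<Phi>"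
  then obtain n where \<phi>: "\<phi> = (\<lambda>p t. (curve_deriv A ^^ n) (fst p) t \<oplus> (curve_deriv A ^^ n) (snd p) t)"
    by blast
  show "continuous_map (prod_topology (prod_topology (smooth_compact_open_topology A)
      (smooth_compact_open_topology A)) euclideanreal) (topol A) (\<lambda>x. \<phi> (fst x) (snd x))"
    unfolding \<phi>
    by (intro continuous_map_alg_add continuous_map_smooth_eval_of continuous_map_snd
        continuous_map_fst_fst continuous_map_snd_fst)
  show "\<exists>\<phi>'\<in>?\<Phi>. \<forall>p\<in>topspace (prod_topology (smooth_compact_open_topology A)
      (smooth_compact_open_topology A)). \<forall>t. has_curve_derivative A (\<phi> p) (\<phi>' p t) t"
    unfolding \<phi>
    by (rule bexI[OF _ rangeI[of _ "Suc n"]])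
      (auto intro!: has_curve_derivative_add smooth_curves_funpow(2)[of _ n, simplified] smooth_curves_funpow(3))
qed

lemma continuous_map_smooth_smult:
  "continuous_map (prod_topology euclidean (smooth_compact_open_topology A))
     (smooth_compact_open_topology A) (\<lambda>p t. fst p \<odot> snd p t)"
proof (rule continuous_map_smooth_coinduct)
  let ?\<Phi> = "range (\<lambda>n (p :: complex \<times> (real \<Rightarrow> 'a)) t. fst p \<odot> (curve_deriv A ^^ n) (snd p) t)"
  show "(\<lambda>p t. fst p \<odot> snd p t) \<in> ?\<Phi>" by (rule range_eqI[of _ _ 0]) simp
  fix \<phi> assume "\<phi> \<in> ?\<Phi>"
  then obtain n where \<phi>: "\<phi> = (\<lambda>p t. fst p \<odot> (curve_deriv A ^^ n) (snd p) t)"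
    by blast
  show "continuous_map (prod_topology (prod_topology euclidean
      (smooth_compact_open_topology A)) euclideanreal) (topol A) (\<lambda>x. \<phi> (fst x) (snd x))"
    unfolding \<phi>
    by (intro continuous_map_alg_smult continuous_map_smooth_eval_of continuous_map_snd
        continuous_map_fst_fst continuous_map_snd_fst)
  show "\<exists>\<phi>'\<in>?\<Phi>. \<forall>p\<in>topspace (prod_topology euclidean
      (smooth_compact_open_topology A)). \<forall>t. has_curve_derivative A (\<phi> p) (\<phi>' p t) t"
    unfolding \<phi>
    by (rule bexI[OF _ rangeI[of _ "Suc n"]])
      (auto intro!: has_curve_derivative_smult smooth_curves_funpow(2)[of _ n, simplified] smooth_curves_funpow(3))
qed

text \<open>By the product rule this family is closed under differentiation, as the coinduction requires.\<close>

inductive_set product_families :: "((real \<Rightarrow> 'a) \<times> (real \<Rightarrow> 'a) \<Rightarrow> real \<Rightarrow> 'a) set" where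
  prod: "(\<lambda>p t. (curve_deriv A ^^ i) (fst p) t \<otimes> (curve_deriv A ^^ j) (snd p) t) \<in> product_families"
| sum: "\<phi> \<in> product_families \<Longrightarrow> \<psi> \<in> product_families \<Longrightarrow> (\<lambda>p t. \<phi> p t \<oplus> \<psi> p t) \<in> product_families"

text \<open>\<open>product_families\<close> absorbs the Leibniz formula: the product rule for a
  single derivative is enough, and no binomial coefficients have to be tracked.\<close>

lemma continuous_map_smooth_mult:
  "continuous_map (prod_topology (smooth_compact_open_topology A) (smooth_compact_open_topology A))
     (smooth_compact_open_topology A) (\<lambda>p t. fst p t \<otimes> snd p t)"
proof (rule continuous_map_smooth_coinduct)
  let ?S = "smooth_compact_open_topology A"
  show "(\<lambda>p t. fst p t \<otimes> snd p t) \<in> product_families"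
    using product_families.prod[of 0 0] by simp
  fix \<phi> assume \<phi>: "\<phi> \<in> product_families"
  then show "continuous_map (prod_topology (prod_topology ?S ?S) euclideanreal) (topol A)
      (\<lambda>x. \<phi> (fst x) (snd x))"
  proof induction
    case prod show ?case
      by (intro continuous_map_alg_mult continuous_map_smooth_eval_of continuous_map_snd
        continuous_map_fst_fst continuous_map_snd_fst)
  qed (rule continuous_map_alg_add)
  \<comment> \<open>The rule for the derivative of a sum requires both curves to stay in the
    carrier, which the case \<open>sum\<close> below draws from this separate induction.\<close>
  have car: "\<phi> p t \<in> carrier A" if "\<phi> \<in> product_families" "p \<in> topspace (prod_topology ?S ?S)" for \<phi> p t
    using that by induction (auto simp: smooth_curves_funpow(3))
  from \<phi> show "\<exists>\<phi>'\<in>product_families. \<forall>p\<in>topspace (prod_topology ?S ?S). \<forall>t.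
      has_curve_derivative A (\<phi> p) (\<phi>' p t) t"
  proof induction
    case (prod i j)
    let ?D = "\<lambda>i f. (curve_deriv A ^^ i) f"
    have "has_curve_derivative A (\<lambda>t. ?D i f t \<otimes> ?D j g t)
        (?D (Suc i) f t \<otimes> ?D j g t \<oplus> ?D i f t \<otimes> ?D (Suc j) g t) t"
      if "f \<in> smooth_curves A" "g \<in> smooth_curves A" for f g t
      by (intro has_curve_derivative_mult smooth_curves_funpow that)
        (auto intro: smooth_curves_funpow(3) that)
    then show ?case
      by (intro bexI[OF _ product_families.sum[OF product_families.prod[of "Suc i" j]
              product_families.prod[of i "Suc j"]]]) (simp add: mem_Times_iff)
  next
    case (sum \<phi> \<psi>)
    then obtain \<phi>' \<psi>' where "\<phi>' \<in> product_families" "\<psi>' \<in> product_families"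
      "\<And>p t. p \<in> topspace (prod_topology ?S ?S) \<Longrightarrow> has_curve_derivative A (\<phi> p) (\<phi>' p t) t"
      "\<And>p t. p \<in> topspace (prod_topology ?S ?S) \<Longrightarrow> has_curve_derivative A (\<psi> p) (\<psi>' p t) t"
      by blast
    with sum.hyps show ?case
      by (intro bexI[OF _ product_families.sum[of \<phi>' \<psi>']])
        (auto intro!: has_curve_derivative_add car)
  qed
qed

section \<open>Smoothness of constant and linear curves\<close>

lemma const_smooth:
  assumes "a \<in> carrier A" shows "(\<lambda>_. a) \<in> smooth_curves A"
proof -
  \<comment> \<open>Over a one-point parameter space the coinduction principle becomes a criterion
    for smoothness, since continuity into the curve topology includes that the value is a smooth
    curve.\<close>
  have "continuous_map (discrete_topology {()}) (smooth_compact_open_topology A) (\<lambda>_ _. a)"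
    by (rule continuous_map_smooth_coinduct[where \<Phi> = "{\<lambda>_ _. a, \<lambda>_ _. \<zero>}"])
      (use assms in \<open>auto intro: has_curve_derivative_const\<close>)
  from continuous_map_image_subset_topspace[OF this] show ?thesis by simp
qed

lemma linear_smooth:
  assumes "a \<in> carrier A" shows "(\<lambda>t. complex_of_real t \<odot> a) \<in> smooth_curves A"
proof -
  have "continuous_map T euclidean (\<lambda>x. complex_of_real (f x))"
    if "continuous_map T euclideanreal f" for T :: "(unit \<times> real) topology" and f
    using continuous_map_compose[OF that, of euclidean complex_of_real]
    by (simp add: o_def continuous_on_of_real)
  \<comment> \<open>Successive derivatives of the linear curve are the constant \<open>a\<close> and
    then zero, so three families are closed under differentiation.\<close>
  then have "continuous_map (discrete_topology {()}) (smooth_compact_open_topology A)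
      (\<lambda>_ t. complex_of_real t \<odot> a)"
    by (intro continuous_map_smooth_coinduct[where
          \<Phi> = "{\<lambda>_ t. complex_of_real t \<odot> a, \<lambda>_ _. a, \<lambda>_ _. \<zero>}"])
      (use assms in \<open>auto intro!: has_curve_derivative_const has_curve_derivative_linear
        continuous_map_alg_smult continuous_map_snd\<close>)
  from continuous_map_image_subset_topspace[OF this] show ?thesis by simp
qed

end

section \<open>The algebra of smooth curves\<close>

context lc_alg
begin

lemma smooth_curves_add:
  "f \<in> smooth_curves A \<Longrightarrow> g \<in> smooth_curves A \<Longrightarrow> (\<lambda>t. f t \<oplus> g t) \<in> smooth_curves A"
  using continuous_map_image_subset_topspace[OF continuous_map_smooth_add]
  by (auto simp: image_subset_iff)

lemma smooth_curves_smult: "f \<in> smooth_curves A \<Longrightarrow> (\<lambda>t. c \<odot> f t) \<in> smooth_curves A"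
  using continuous_map_image_subset_topspace[OF continuous_map_smooth_smult]
  by (auto simp: image_subset_iff)

lemma smooth_curves_mult:
  "f \<in> smooth_curves A \<Longrightarrow> g \<in> smooth_curves A \<Longrightarrow> (\<lambda>t. f t \<otimes> g t) \<in> smooth_curves A"
  using continuous_map_image_subset_topspace[OF continuous_map_smooth_mult]
  by (auto simp: image_subset_iff)

text \<open>Linearity of iterated derivatives, established here and in the next lemma, carries
  convexity from sets in \<open>A\<close> to the subbasic sets of curves.\<close>

lemma funpow_curve_deriv_add:
  assumes "f \<in> smooth_curves A" "g \<in> smooth_curves A"
  shows "(curve_deriv A ^^ n) (\<lambda>t. f t \<oplus> g t)
    = (\<lambda>t. (curve_deriv A ^^ n) f t \<oplus> (curve_deriv A ^^ n) g t)"
proof (induction n)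
  case (Suc n)
  have "curve_deriv A (\<lambda>t. (curve_deriv A ^^ n) f t \<oplus> (curve_deriv A ^^ n) g t)
      = (\<lambda>t. (curve_deriv A ^^ Suc n) f t \<oplus> (curve_deriv A ^^ Suc n) g t)"
    by (intro curve_deriv_eqI has_curve_derivative_add smooth_curves_funpow assms)
      (auto intro: smooth_curves_funpow(3) assms)
  with Suc show ?case by simp
qed simp

lemma funpow_curve_deriv_smult:
  assumes "f \<in> smooth_curves A"
  shows "(curve_deriv A ^^ n) (\<lambda>t. c \<odot> f t) = (\<lambda>t. c \<odot> (curve_deriv A ^^ n) f t)"
proof (induction n)
  case (Suc n)
  have "curve_deriv A (\<lambda>t. c \<odot> (curve_deriv A ^^ n) f t) = (\<lambda>t. c \<odot> (curve_deriv A ^^ Suc n) f t)"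
    by (intro curve_deriv_eqI has_curve_derivative_smult smooth_curves_funpow assms)
      (auto intro: smooth_curves_funpow(3) assms)
  with Suc show ?case by simp
qed simp

lemma funpow_curve_deriv_zero: "(curve_deriv A ^^ n) (\<lambda>_. \<zero>) = (\<lambda>_. \<zero>)"
proof (induction n)
  case (Suc n)
  have "curve_deriv A (\<lambda>_. \<zero>) = (\<lambda>_. \<zero>)"
    by (intro curve_deriv_eqI has_curve_derivative_const) simp
  with Suc show ?case by simp
qed simp

lemma ring_smooth_curve_algebra: "ring (smooth_curve_algebra A)"
proof (intro ringI abelian_groupI monoidI)
  show "\<exists>g\<in>carrier (smooth_curve_algebra A). g \<oplus>\<^bsub>smooth_curve_algebra A\<^esub> f = \<zero>\<^bsub>smooth_curve_algebra A\<^esub>"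
    if "f \<in> carrier (smooth_curve_algebra A)" for f
  \<comment> \<open>Taking the additive inverse as a scalar multiple reduces its smoothness to
    closure under scalar multiplication.\<close>
  proof (rule bexI[of _ "\<lambda>t. (-1) \<odot> f t"])
    show "(\<lambda>t. - 1 \<odot> f t) \<in> carrier (smooth_curve_algebra A)"
      using that smooth_curves_smult by (simp add: smooth_curve_algebra_def)
    show "(\<lambda>t. - 1 \<odot> f t) \<oplus>\<^bsub>smooth_curve_algebra A\<^esub> f = \<zero>\<^bsub>smooth_curve_algebra A\<^esub>"
      using that smooth_curves_carrier[of f]
      by (simp add: smooth_curve_algebra_def smult_minus_one l_neg)
  qed
qed (auto simp: smooth_curve_algebra_def smooth_curves_carrier smooth_curves_add smooth_curves_mult
      const_smooth a_ac m_assoc l_distr r_distr)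

lemma module_smooth_curve_algebra: "Module.module complex_ring (smooth_curve_algebra A)"
proof (intro moduleI cring_from_type_algebra)
  show "abelian_group (smooth_curve_algebra A)"
    using ring_smooth_curve_algebra by (simp add: ring_def)
qed (auto simp: smooth_curve_algebra_def ring_of_type_algebra_def smooth_curves_smult smooth_curves_carrier
      smult_l_distr smult_r_distr smult_assoc1)

text \<open>Distinct curves differ at some time t. The subbasic sets with n = 0 and K = {t} separate
  them just as \<open>A\<close> separates their values at t.\<close>

lemma Hausdorff_smooth: "Hausdorff_space (smooth_compact_open_topology A)"
  unfolding Hausdorff_space_def
proof (intro allI impI, elim conjE)
  fix f g assume fg: "f \<in> topspace (smooth_compact_open_topology A)"
    "g \<in> topspace (smooth_compact_open_topology A)" "f \<noteq> g"
  then obtain t where "f t \<noteq> g t" by blast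
  then obtain U V where UV: "openin (topol A) U" "openin (topol A) V" "f t \<in> U" "g t \<in> V" "disjnt U V"
    using Hausdorff fg smooth_curves_carrier unfolding Hausdorff_space_def by (metis topspace_topol topspace_smooth)
  let ?N = "\<lambda>U. {h \<in> smooth_curves A. (curve_deriv A ^^ 0) h ` {t} \<subseteq> U}"
  have "openin (smooth_compact_open_topology A) (?N U)" "openin (smooth_compact_open_topology A) (?N V)"
    using UV by (intro openin_smooth_subbasis; simp)+
  moreover have "f \<in> ?N U" "g \<in> ?N V" "disjnt (?N U) (?N V)"
    using UV fg by (auto simp: disjnt_iff)
  ultimately show "\<exists>U V. openin (smooth_compact_open_topology A) U \<and>
      openin (smooth_compact_open_topology A) V \<and> f \<in> U \<and> g \<in> V \<and> disjnt U V" by blast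
qed

lemma convex_in_smooth_subbasis:
  assumes "convex_in A V"
  shows "convex_in (smooth_curve_algebra A) {f \<in> smooth_curves A. (curve_deriv A ^^ n) f ` K \<subseteq> V}"
  using assms unfolding convex_in_def
  by (auto simp: smooth_curve_algebra_def smooth_curves_add smooth_curves_smult
      funpow_curve_deriv_add funpow_curve_deriv_smult image_subset_iff)

text \<open>The induction follows the generation of the topology from its subbasis: an intersection
  of convex sets is convex, a union is served by one of its members, and a subbasic set shrinks to a
  convex one when \<open>U\<close> is replaced by a convex \<open>V\<close>.\<close>

lemma convex_nhd_smooth:
  assumes "openin (smooth_compact_open_topology A) W" "(\<lambda>_. \<zero>) \<in> W"
  shows "\<exists>V. openin (smooth_compact_open_topology A) V \<and> (\<lambda>_. \<zero>) \<in> V \<and> V \<subseteq> W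
    \<and> convex_in (smooth_curve_algebra A) V"
proof -
  have "generate_topology_on {{f \<in> smooth_curves A. (curve_deriv A ^^ n) f ` K \<subseteq> U} | n K U.
          compact K \<and> openin (topol A) U} W"
    using assms(1) unfolding smooth_compact_open_topology_def by (rule openin_topology_generated_by)
  then show ?thesis using assms(2)
  proof induction
    case (Int W1 W2)
    then obtain V1 V2 where "openin (smooth_compact_open_topology A) V1" "(\<lambda>_. \<zero>) \<in> V1" "V1 \<subseteq> W1"
      "convex_in (smooth_curve_algebra A) V1"
      "openin (smooth_compact_open_topology A) V2" "(\<lambda>_. \<zero>) \<in> V2" "V2 \<subseteq> W2"
      "convex_in (smooth_curve_algebra A) V2" by blast
    then show ?case
      by (intro exI[of _ "V1 \<inter> V2"]) (auto simp: convex_in_def)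
  next
    case (UN \<K>)
    then obtain W' where "W' \<in> \<K>" "(\<lambda>_. \<zero>) \<in> W'" by blast
    with UN.IH[of W'] show ?case by blast
  next
    case (Basis W)
    then obtain n K U where W: "W = {f \<in> smooth_curves A. (curve_deriv A ^^ n) f ` K \<subseteq> U}"
      and K: "compact K" and U: "openin (topol A) U" by blast
    show ?case
    \<comment> \<open>With K empty, membership of the zero curve says nothing about
      \<open>U\<close>, so no convex \<open>V\<close> can be extracted; but then \<open>W\<close>
      consists of all smooth curves and is itself convex.\<close>
    proof (cases "K = {}")
      case True
      have "convex_in A (carrier A)" by (simp add: convex_in_def)
      from convex_in_smooth_subbasis[OF this, of n K] True Basis.prems show ?thesis
        using openin_smooth_subbasis[OF K U, of n] unfolding W by auto
    next
      case False
      then have "\<zero> \<in> U" using Basis.prems W by (auto simp: funpow_curve_deriv_zero)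
      with U obtain V where V: "openin (topol A) V" "\<zero> \<in> V" "V \<subseteq> U" "convex_in A V"
        using convex_nhd by blast
      have "(\<lambda>_. \<zero>) \<in> {f \<in> smooth_curves A. (curve_deriv A ^^ n) f ` K \<subseteq> V}"
        using V(2) by (auto simp: funpow_curve_deriv_zero const_smooth)
      then show ?thesis
        using openin_smooth_subbasis[OF K V(1), of n] convex_in_smooth_subbasis[OF V(4), of n K] V(3)
        unfolding W by blast
    qed
  qed simp
qed

lemma lc_algebra_smooth_curve_algebra: "lc_algebra (smooth_curve_algebra A)"
  unfolding lc_algebra_def
  using ring_smooth_curve_algebra module_smooth_curve_algebra Hausdorff_smooth convex_nhd_smooth
    continuous_map_smooth_add continuous_map_smooth_smult continuous_map_smooth_mult
  by (simp add: smooth_curve_algebra_def case_prod_unfold fun_eq_iff smooth_curves_carrier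
      smult_mult_left smult_mult_right)

end

section \<open>Quotients by closed ideals\<close>

text \<open>A point of \<open>W\<close> has a box around it inside \<open>W\<close>, and the image
  of a box is the box of the open images. Applied below to the coset map.\<close>

lemma open_map_prod_topology:
  assumes f: "open_map T T' f" and g: "open_map U U' g"
  shows "open_map (prod_topology T U) (prod_topology T' U') (\<lambda>p. (f (fst p), g (snd p)))"
  unfolding open_map_def
proof (intro allI impI)
  fix W assume W: "openin (prod_topology T U) W"
  have "\<exists>P Q. openin T' P \<and> openin U' Q \<and> x \<in> P \<and> y \<in> Q
      \<and> P \<times> Q \<subseteq> (\<lambda>p. (f (fst p), g (snd p))) ` W"
    if xy: "(x, y) \<in> (\<lambda>p. (f (fst p), g (snd p))) ` W" for x y
  proof -
    obtain a b where ab: "(a, b) \<in> W" "x = f a" "y = g b" using xy by auto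
    then obtain P Q where PQ: "openin T P" "openin U Q" "a \<in> P" "b \<in> Q" "P \<times> Q \<subseteq> W"
      using openin_prod_topology_alt[THEN iffD1, rule_format, OF W ab(1)] by meson
    have "f ` P \<times> g ` Q \<subseteq> (\<lambda>p. (f (fst p), g (snd p))) ` W"
      using PQ(5) by force
    moreover have "openin T' (f ` P)" "openin U' (g ` Q)"
      using f g PQ by (auto simp: open_map_def)
    ultimately show ?thesis using PQ ab by blast
  qed
  then show "openin (prod_topology T' U') ((\<lambda>p. (f (fst p), g (snd p))) ` W)"
    unfolding openin_prod_topology_alt by blast
qed

text \<open>Every operation under which an ideal must be closed is continuous and preserves J, hence
  preserves the closure. Operations in one variable go through \<open>img\<close>; addition uses
  that the closure of J x J is the product of the closures.\<close>

lemma (in lc_alg) ideal_closure_of: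
  assumes "ideal J A"
  shows "ideal (topol A closure_of J) A"
proof -
  interpret J: ideal J A by fact
  let ?C = "topol A closure_of J"
  have sub: "?C \<subseteq> carrier A" using closure_of_subset_topspace[of "topol A" J] by simp
  have J: "J \<subseteq> ?C" by (rule closure_of_subset) (use J.a_subset in simp)
  have img: "h x \<in> ?C" if "continuous_map (topol A) (topol A) h" "h ` J \<subseteq> J" "x \<in> ?C" for h x
    using continuous_map_image_closure_subset[OF that(1), of J] closure_of_mono[OF that(2), of "topol A"] that(3)
    by blast
  have add: "x \<oplus> y \<in> ?C" if "x \<in> ?C" "y \<in> ?C" for x y
  proof -
    have c: "continuous_map (prod_topology (topol A) (topol A)) (topol A) (\<lambda>p. fst p \<oplus> snd p)"
      by (intro continuous_map_alg_add continuous_map_fst continuous_map_snd)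
    have "(x, y) \<in> prod_topology (topol A) (topol A) closure_of (J \<times> J)"
      using that by (simp add: closure_of_Times)
    then have "x \<oplus> y \<in> topol A closure_of ((\<lambda>p. fst p \<oplus> snd p) ` (J \<times> J))"
      using continuous_map_image_closure_subset[OF c, of "J \<times> J"] by force
    moreover have "(\<lambda>p. fst p \<oplus> snd p) ` (J \<times> J) \<subseteq> J" by auto
    ultimately show ?thesis
      using closure_of_mono by blast
  qed
  \<comment> \<open>A ring ideal of a unital algebra absorbs scalars, because c x = (c 1) x. The
    case c = -1 makes negation available to \<open>img\<close>.\<close>
  have smult: "c \<odot> x \<in> J" if "x \<in> J" for c x
    using J.I_l_closed[OF that, of "c \<odot> \<one>"] that by (simp add: smult_mult_left)
  have neg: "\<ominus> x \<in> ?C" if "x \<in> ?C" for x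
  proof -
    have "continuous_map (topol A) (topol A) (\<lambda>x. (-1) \<odot> x)"
      using continuous_map_alg_smult[of "topol A" "\<lambda>_. -1" "\<lambda>x. x"] by simp
    from img[OF this _ that] have "(-1) \<odot> x \<in> ?C" using smult by blast
    then show ?thesis using that sub by (simp add: smult_minus_one subset_iff)
  qed
  have id: "continuous_map (topol A) (topol A) (\<lambda>x. x)" by simp
  have mult: "a \<otimes> x \<in> ?C" "x \<otimes> a \<in> ?C" if "a \<in> carrier A" "x \<in> ?C" for a x
  proof -
    have c: "continuous_map (topol A) (topol A) (\<lambda>_. a)" using that by simp
    from img[OF continuous_map_alg_mult[OF c id] _ that(2)] J.I_l_closed that(1)
    show "a \<otimes> x \<in> ?C" by auto
    from img[OF continuous_map_alg_mult[OF id c] _ that(2)] J.I_r_closed that(1)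
    show "x \<otimes> a \<in> ?C" by auto
  qed
  have "subgroup ?C (add_monoid A)"
  proof (rule add.subgroupI)
    show "?C \<noteq> {}" using J J.zero_closed by blast
  qed (use sub add neg in \<open>auto simp: a_inv_def\<close>)
  then show ?thesis by (intro idealI mult ring_axioms)
qed

text \<open>The assumption \<open>closed\<close> is the source of the Hausdorff axiom for the
  quotient. In the application \<open>A\<close> is the curve algebra and \<open>I\<close> the
  localization ideal.\<close>

locale lc_closed_ideal = lc_alg A + ideal I A for A :: "('a, 'b) lc_alg_scheme" (structure) and I +
  assumes closed: "closedin (topol A) I"
begin

abbreviation Q :: "'a set lc_alg" where "Q \<equiv> quotient_algebra A I"

section \<open>Algebra of cosets\<close>

lemma coset_eq_iff: "x \<in> carrier A \<Longrightarrow> y \<in> carrier A \<Longrightarrow> I +> x = I +> y \<longleftrightarrow> x \<ominus> y \<in> I"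
  using a_rcos_module_minus[OF ring_axioms, of y x] a_repr_independence'[of x y] a_rcos_self[of x] by metis

lemma smult_ideal: "x \<in> I \<Longrightarrow> c \<odot> x \<in> I"
  using I_l_closed[of x "c \<odot> \<one>"] by (simp add: smult_mult_left)

lemma carrier_quotient: "carrier Q = (\<lambda>x. I +> x) ` carrier A"
  by (auto simp: quotient_algebra_def FactRing_def A_RCOSETS_def' a_r_coset_def')

lemma coset_in_carrier [simp]: "x \<in> carrier A \<Longrightarrow> I +> x \<in> carrier Q"
  by (simp add: carrier_quotient)

lemma quotient_simps:
  "x \<in> carrier A \<Longrightarrow> y \<in> carrier A \<Longrightarrow> (I +> x) \<otimes>\<^bsub>Q\<^esub> (I +> y) = I +> (x \<otimes> y)"
  "x \<in> carrier A \<Longrightarrow> y \<in> carrier A \<Longrightarrow> (I +> x) \<oplus>\<^bsub>Q\<^esub> (I +> y) = I +> (x \<oplus> y)"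
  "\<one>\<^bsub>Q\<^esub> = I +> \<one>" "\<zero>\<^bsub>Q\<^esub> = I +> \<zero>"
  by (simp_all add: quotient_algebra_def FactRing_def rcoset_mult_add a_rcos_sum a_rcos_const)

text \<open>Scalar multiplication on the quotient and the induced action are both defined as unions
  over all representatives. Such a union collapses to one value as soon as that value does not
  depend on the representative.\<close>

lemma UNION_coset:
  assumes "x \<in> carrier A" "\<And>y. y \<in> carrier A \<Longrightarrow> y \<ominus> x \<in> I \<Longrightarrow> F y = F x"
  shows "(\<Union>y\<in>I +> x. F y) = F x"
proof -
  have "F y = F x" if "y \<in> I +> x" for y
    using that assms a_elemrcos_carrier a_rcos_module_minus[OF ring_axioms] by blast
  then show ?thesis using a_rcos_self[OF assms(1)] by blast
qed

lemma quotient_smult: "x \<in> carrier A \<Longrightarrow> c \<odot>\<^bsub>Q\<^esub> (I +> x) = I +> (c \<odot> x)"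
  unfolding quotient_algebra_def
  by (simp, rule UNION_coset)
    (auto simp: coset_eq_iff smult_diff[symmetric] smult_ideal)

lemma ring_quotient: "ring Q"
proof (intro ringI abelian_groupI monoidI)
  show "\<exists>Y\<in>carrier Q. Y \<oplus>\<^bsub>Q\<^esub> Z = \<zero>\<^bsub>Q\<^esub>" if Z: "Z \<in> carrier Q" for Z
  proof -
    obtain z where "z \<in> carrier A" "Z = I +> z" using Z by (auto simp: carrier_quotient)
    then show ?thesis
      by (intro bexI[of _ "I +> (\<ominus> z)"]) (auto simp: quotient_simps l_neg)
  qed
qed (auto simp: carrier_quotient quotient_simps a_ac m_assoc l_distr r_distr)

lemma module_quotient: "Module.module complex_ring Q"
proof (intro moduleI cring_from_type_algebra)
  show "abelian_group Q"
    using ring_quotient by (simp add: ring_def)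
qed (auto simp: carrier_quotient quotient_simps quotient_smult ring_of_type_algebra_def
      smult_l_distr smult_r_distr smult_assoc1)

section \<open>The quotient topology and continuity of the induced operations\<close>

lemma openin_quotient:
  "openin (topol Q) W \<longleftrightarrow> W \<subseteq> carrier Q \<and> openin (topol A) {x \<in> carrier A. I +> x \<in> W}"
  using openin_quotient_topol[of A I W] by (simp add: quotient_algebra_def)

lemma topspace_quotient: "topspace (topol Q) = carrier Q"
proof -
  have "{x \<in> carrier A. I +> x \<in> carrier Q} = topspace (topol A)" by auto
  then have "openin (topol Q) (carrier Q)"
    by (simp add: openin_quotient del: topspace_topol)
  then show ?thesis using openin_subset[of "topol Q"] openin_topspace[of "topol Q"]
    by (metis openin_quotient subset_antisym)
qed

lemma continuous_map_coset: "continuous_map (topol A) (topol Q) (\<lambda>x. I +> x)"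
  by (auto simp: continuous_map_def topspace_quotient openin_quotient)

text \<open>The saturation of an open \<open>U\<close> is the union of its translates by elements of
  \<open>I\<close>, each of which is open as the preimage of \<open>U\<close> under subtraction of a
  fixed element.\<close>

lemma open_map_coset: "open_map (topol A) (topol Q) (\<lambda>x. I +> x)"
  unfolding open_map_def
proof (intro allI impI)
  fix U assume U: "openin (topol A) U"
  then have Uc: "U \<subseteq> carrier A" using openin_subset by fastforce
  have "{x \<in> carrier A. I +> x \<in> (\<lambda>x. I +> x) ` U} = (\<Union>i\<in>I. {x \<in> topspace (topol A). x \<ominus> i \<in> U})"
  proof (intro Set.set_eqI iffI)
    fix x assume "x \<in> {x \<in> carrier A. I +> x \<in> (\<lambda>x. I +> x) ` U}"
    then obtain u where u: "x \<in> carrier A" "u \<in> U" "I +> x = I +> u" by auto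
    then have "x \<ominus> u \<in> I" using Uc by (auto simp: coset_eq_iff)
    moreover have "x \<ominus> (x \<ominus> u) = u" using u(1) subsetD[OF Uc u(2)] by algebra
    ultimately show "x \<in> (\<Union>i\<in>I. {x \<in> topspace (topol A). x \<ominus> i \<in> U})"
      using u by (intro UN_I[of "x \<ominus> u"]) auto
  next
    fix x assume "x \<in> (\<Union>i\<in>I. {x \<in> topspace (topol A). x \<ominus> i \<in> U})"
    then obtain i where i: "i \<in> I" "x \<in> carrier A" "x \<ominus> i \<in> U" by auto
    moreover have "x \<ominus> (x \<ominus> i) = i" using i(2) a_Hcarr[OF i(1)] by algebra
    ultimately have "I +> x = I +> (x \<ominus> i)" using Uc by (subst coset_eq_iff) auto
    with i show "x \<in> {x \<in> carrier A. I +> x \<in> (\<lambda>x. I +> x) ` U}" by auto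
  qed
  moreover have "openin (topol A) {x \<in> topspace (topol A). x \<ominus> i \<in> U}" if "i \<in> I" for i
    by (rule openin_continuous_map_preimage[OF continuous_map_alg_diff U]) (use that in auto)
  ultimately show "openin (topol Q) ((\<lambda>x. I +> x) ` U)"
    using Uc by (auto simp: openin_quotient)
qed

text \<open>Along such a quotient map, joint continuity can be checked on representatives. The
  factor \<open>f\<close> is the coset map again for addition and multiplication, and the identity
  on the scalars for scalar multiplication.\<close>

lemma quotient_map_coset_Times:
  assumes "open_map T T' f" "continuous_map T T' f" "f ` topspace T = topspace T'"
  shows "quotient_map (prod_topology T (topol A)) (prod_topology T' (topol Q))
    (\<lambda>p. (f (fst p), I +> snd p))"
proof (rule continuous_open_imp_quotient_map)
  have "continuous_map (prod_topology T (topol A)) T' (\<lambda>p. f (fst p))"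
    using continuous_map_compose[OF continuous_map_fst assms(2)] by (simp add: o_def)
  moreover have "continuous_map (prod_topology T (topol A)) (topol Q) (\<lambda>p. I +> snd p)"
    using continuous_map_compose[OF continuous_map_snd continuous_map_coset] by (simp add: o_def)
  ultimately show "continuous_map (prod_topology T (topol A)) (prod_topology T' (topol Q))
      (\<lambda>p. (f (fst p), I +> snd p))"
    by (rule continuous_map_pairedI)
  show "open_map (prod_topology T (topol A)) (prod_topology T' (topol Q)) (\<lambda>p. (f (fst p), I +> snd p))"
    by (rule open_map_prod_topology[OF assms(1) open_map_coset])
  have "(\<lambda>p. (f (fst p), I +> snd p)) ` (topspace T \<times> carrier A)
      = (f ` topspace T) \<times> ((\<lambda>x. I +> x) ` carrier A)"
    by force
  then show "(\<lambda>p. (f (fst p), I +> snd p)) ` topspace (prod_topology T (topol A))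
      = topspace (prod_topology T' (topol Q))"
    using assms(3) by (simp add: topspace_quotient carrier_quotient)
qed

lemma quotient_map_coset_coset:
  "quotient_map (prod_topology (topol A) (topol A)) (prod_topology (topol Q) (topol Q))
    (\<lambda>p. (I +> fst p, I +> snd p))"
  by (rule quotient_map_coset_Times[OF open_map_coset continuous_map_coset])
    (simp add: topspace_quotient carrier_quotient)

lemma quotient_map_id_coset:
  "quotient_map (prod_topology euclidean (topol A)) (prod_topology euclidean (topol Q))
    (\<lambda>p. (fst p :: complex, I +> snd p))"
  by (rule quotient_map_coset_Times[where f = "\<lambda>x. x"]) (auto simp: open_map_def)

lemma continuous_map_quotient_add:
  "continuous_map (prod_topology (topol Q) (topol Q)) (topol Q) (\<lambda>(x, y). x \<oplus>\<^bsub>Q\<^esub> y)"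
proof (rule continuous_compose_quotient_map[OF quotient_map_coset_coset])
  have "continuous_map (prod_topology (topol A) (topol A)) (topol A) (\<lambda>p. fst p \<oplus> snd p)"
    by (intro continuous_map_alg_add continuous_map_fst continuous_map_snd)
  from continuous_map_compose[OF this continuous_map_coset]
  show "continuous_map (prod_topology (topol A) (topol A)) (topol Q)
      ((\<lambda>(x, y). x \<oplus>\<^bsub>Q\<^esub> y) \<circ> (\<lambda>p. (I +> fst p, I +> snd p)))"
    by (rule continuous_map_eq) (auto simp: quotient_simps)
qed

lemma continuous_map_quotient_mult:
  "continuous_map (prod_topology (topol Q) (topol Q)) (topol Q) (\<lambda>(x, y). x \<otimes>\<^bsub>Q\<^esub> y)"
proof (rule continuous_compose_quotient_map[OF quotient_map_coset_coset])
  have "continuous_map (prod_topology (topol A) (topol A)) (topol A) (\<lambda>p. fst p \<otimes> snd p)"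
    by (intro continuous_map_alg_mult continuous_map_fst continuous_map_snd)
  from continuous_map_compose[OF this continuous_map_coset]
  show "continuous_map (prod_topology (topol A) (topol A)) (topol Q)
      ((\<lambda>(x, y). x \<otimes>\<^bsub>Q\<^esub> y) \<circ> (\<lambda>p. (I +> fst p, I +> snd p)))"
    by (rule continuous_map_eq) (auto simp: quotient_simps)
qed

lemma continuous_map_quotient_smult:
  "continuous_map (prod_topology euclidean (topol Q)) (topol Q) (\<lambda>(c, x). c \<odot>\<^bsub>Q\<^esub> x)"
proof (rule continuous_compose_quotient_map[OF quotient_map_id_coset])
  have "continuous_map (prod_topology euclidean (topol A)) (topol A) (\<lambda>p. fst p \<odot> snd p)"
    by (intro continuous_map_alg_smult continuous_map_fst continuous_map_snd)
  from continuous_map_compose[OF this continuous_map_coset]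
  show "continuous_map (prod_topology euclidean (topol A)) (topol Q)
      ((\<lambda>(c, x). c \<odot>\<^bsub>Q\<^esub> x) \<circ> (\<lambda>p. (fst p, I +> snd p)))"
    by (rule continuous_map_eq) (auto simp: quotient_smult)
qed

text \<open>As \<open>I\<close> is closed, the pairs whose difference avoids \<open>I\<close> form
  an open set. The two sides of a box inside it have open images under the coset map, and these
  images cannot meet.\<close>

lemma Hausdorff_quotient: "Hausdorff_space (topol Q)"
  unfolding Hausdorff_space_def
proof (intro allI impI, elim conjE)
  fix Y Z assume YZ: "Y \<in> topspace (topol Q)" "Z \<in> topspace (topol Q)" "Y \<noteq> Z"
  then obtain y z where y: "y \<in> carrier A" "Y = I +> y" and z: "z \<in> carrier A" "Z = I +> z"
    by (auto simp: topspace_quotient carrier_quotient)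
  let ?W = "{p \<in> topspace (prod_topology (topol A) (topol A)). fst p \<ominus> snd p \<in> carrier A - I}"
  have "openin (topol A) (carrier A - I)" using closed by (simp add: closedin_def)
  then have "openin (prod_topology (topol A) (topol A)) ?W"
    by (rule openin_continuous_map_preimage[OF continuous_map_alg_diff[OF continuous_map_fst continuous_map_snd]])
  moreover have "(y, z) \<in> ?W" using YZ(3) y z by (simp add: coset_eq_iff)
  ultimately obtain U V where UV: "openin (topol A) U" "openin (topol A) V" "y \<in> U" "z \<in> V" "U \<times> V \<subseteq> ?W"
    using openin_prod_topology_alt[THEN iffD1, rule_format, of "topol A" "topol A" ?W y z] by meson
  have "disjnt ((\<lambda>x. I +> x) ` U) ((\<lambda>x. I +> x) ` V)"
  proof -
    have "I +> u \<noteq> I +> v" if "u \<in> U" "v \<in> V" for u v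
      using UV(5) that by (subst coset_eq_iff) (auto simp: subset_iff)
    then show ?thesis by (auto simp: disjnt_iff)
  qed
  moreover have "openin (topol Q) ((\<lambda>x. I +> x) ` U)" "openin (topol Q) ((\<lambda>x. I +> x) ` V)"
    using UV open_map_coset by (auto simp: open_map_def)
  ultimately show "\<exists>U V. openin (topol Q) U \<and> openin (topol Q) V \<and> Y \<in> U \<and> Z \<in> V \<and> disjnt U V"
    using UV y z by blast
qed

text \<open>A convex neighbourhood is chosen inside the preimage of \<open>W\<close> and pushed
  forward: the coset map is linear and open, so the image is still convex and open.\<close>

lemma convex_nhd_quotient:
  assumes W: "openin (topol Q) W" "\<zero>\<^bsub>Q\<^esub> \<in> W"
  shows "\<exists>V. openin (topol Q) V \<and> \<zero>\<^bsub>Q\<^esub> \<in> V \<and> V \<subseteq> W \<and> convex_in Q V"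
proof -
  have "openin (topol A) {x \<in> carrier A. I +> x \<in> W}" using W by (simp add: openin_quotient)
  moreover have "\<zero> \<in> {x \<in> carrier A. I +> x \<in> W}" using W by (simp add: quotient_simps)
  ultimately obtain V where V: "openin (topol A) V" "\<zero> \<in> V" "V \<subseteq> {x \<in> carrier A. I +> x \<in> W}" "convex_in A V"
    by (rule convex_nhd)
  have "convex_in Q ((\<lambda>x. I +> x) ` V)"
    unfolding convex_in_def
  proof (intro ballI allI impI)
    fix Y Z and t :: real assume "Y \<in> (\<lambda>x. I +> x) ` V" "Z \<in> (\<lambda>x. I +> x) ` V" and t: "0 \<le> t \<and> t \<le> 1"
    then obtain y z where yz: "y \<in> V" "Y = I +> y" "z \<in> V" "Z = I +> z" by blast
    then have c: "y \<in> carrier A" "z \<in> carrier A" using V by auto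
    have "complex_of_real (1 - t) \<odot> y \<oplus> complex_of_real t \<odot> z \<in> V"
      using V(4) yz t unfolding convex_in_def by blast
    then have "I +> (complex_of_real (1 - t) \<odot> y \<oplus> complex_of_real t \<odot> z) \<in> (\<lambda>x. I +> x) ` V" by blast
    then show "complex_of_real (1 - t) \<odot>\<^bsub>Q\<^esub> Y \<oplus>\<^bsub>Q\<^esub> complex_of_real t \<odot>\<^bsub>Q\<^esub> Z \<in> (\<lambda>x. I +> x) ` V"
      using c by (simp only: yz quotient_smult quotient_simps smult_closed)
  qed
  moreover have "openin (topol Q) ((\<lambda>x. I +> x) ` V)"
    using V open_map_coset by (auto simp: open_map_def)
  ultimately show ?thesis
    using V by (intro exI[of _ "(\<lambda>x. I +> x) ` V"]) (auto simp: quotient_simps)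
qed

lemma lc_algebra_quotient: "lc_algebra Q"
  unfolding lc_algebra_def
proof (intro conjI allI ballI impI)
  fix c x y assume "x \<in> carrier Q" "y \<in> carrier Q"
  then show "(c \<odot>\<^bsub>Q\<^esub> x) \<otimes>\<^bsub>Q\<^esub> y = c \<odot>\<^bsub>Q\<^esub> (x \<otimes>\<^bsub>Q\<^esub> y)" "x \<otimes>\<^bsub>Q\<^esub> (c \<odot>\<^bsub>Q\<^esub> y) = c \<odot>\<^bsub>Q\<^esub> (x \<otimes>\<^bsub>Q\<^esub> y)"
    by (auto simp: carrier_quotient quotient_simps quotient_smult smult_mult_left smult_mult_right)
qed (use convex_nhd_quotient in \<open>simp_all add: ring_quotient module_quotient topspace_quotient
    Hausdorff_quotient continuous_map_quotient_add continuous_map_quotient_smult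
    continuous_map_quotient_mult\<close>)

end

section \<open>Induced actions\<close>

lemma alg_homD:
  assumes "h \<in> alg_hom A B"
  shows "x \<in> carrier A \<Longrightarrow> h x \<in> carrier B"
    and "x \<in> carrier A \<Longrightarrow> y \<in> carrier A \<Longrightarrow> h (x \<oplus>\<^bsub>A\<^esub> y) = h x \<oplus>\<^bsub>B\<^esub> h y"
    and "x \<in> carrier A \<Longrightarrow> y \<in> carrier A \<Longrightarrow> h (x \<otimes>\<^bsub>A\<^esub> y) = h x \<otimes>\<^bsub>B\<^esub> h y"
    and "x \<in> carrier A \<Longrightarrow> h (c \<odot>\<^bsub>A\<^esub> x) = c \<odot>\<^bsub>B\<^esub> h x"
    and "h \<one>\<^bsub>A\<^esub> = \<one>\<^bsub>B\<^esub>"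
  using assms by (auto simp: alg_hom_def ring_hom_def)

lemma continuous_map_discrete_Times:
  assumes "\<And>l. l \<in> S \<Longrightarrow> continuous_map T U (f l)"
  shows "continuous_map (prod_topology (discrete_topology S) T) U (\<lambda>(l, x). f l x)"
  unfolding continuous_map_def
proof (intro conjI allI impI)
  show "(\<lambda>(l, x). f l x) \<in> topspace (prod_topology (discrete_topology S) T) \<rightarrow> topspace U"
    using assms continuous_map_funspace by fastforce
  fix W assume W: "openin U W"
  have "{x \<in> topspace (prod_topology (discrete_topology S) T). (case x of (l, x) \<Rightarrow> f l x) \<in> W}
      = (\<Union>l\<in>S. {l} \<times> {x \<in> topspace T. f l x \<in> W})"
    by auto
  moreover have "openin (prod_topology (discrete_topology S) T) ({l} \<times> {x \<in> topspace T. f l x \<in> W})"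
    if "l \<in> S" for l
    using that openin_continuous_map_preimage[OF assms W] by (simp add: openin_prod_Times_iff)
  ultimately show "openin (prod_topology (discrete_topology S) T)
      {x \<in> topspace (prod_topology (discrete_topology S) T). (case x of (l, x) \<Rightarrow> f l x) \<in> W}"
    by auto
qed

text \<open>Bijectivity need not be supplied, since the inverse group element provides the inverse
  map. Continuity of each single \<open>\<alpha> l\<close> yields joint continuity, since the group
  is discrete.\<close>

lemma dynamical_systemI:
  assumes A: "lc_algebra A" and L: "group L"
    and ext: "\<And>l. l \<in> carrier L \<Longrightarrow> \<alpha> l \<in> extensional (carrier A)"
    and hom: "\<And>l. l \<in> carrier L \<Longrightarrow> \<alpha> l \<in> alg_hom A A"
    and cont: "\<And>l. l \<in> carrier L \<Longrightarrow> continuous_map (topol A) (topol A) (\<alpha> l)"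
    and mult: "\<And>l m x. l \<in> carrier L \<Longrightarrow> m \<in> carrier L \<Longrightarrow> x \<in> carrier A \<Longrightarrow>
      \<alpha> (l \<otimes>\<^bsub>L\<^esub> m) x = \<alpha> l (\<alpha> m x)"
    and one: "\<And>x. x \<in> carrier A \<Longrightarrow> \<alpha> \<one>\<^bsub>L\<^esub> x = x"
  shows "dynamical_system A L \<alpha>"
proof -
  interpret L: group L by fact
  have bij: "\<alpha> l \<in> Bij (carrier A)" if l: "l \<in> carrier L" for l
  proof -
    have "bij_betw (\<alpha> l) (carrier A) (carrier A)"
    proof (rule bij_betwI[where g = "\<alpha> (inv\<^bsub>L\<^esub> l)"])
      show "\<alpha> l \<in> carrier A \<rightarrow> carrier A" "\<alpha> (inv\<^bsub>L\<^esub> l) \<in> carrier A \<rightarrow> carrier A"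
        using alg_homD(1)[OF hom] l by auto
      show "\<alpha> (inv\<^bsub>L\<^esub> l) (\<alpha> l x) = x" "\<alpha> l (\<alpha> (inv\<^bsub>L\<^esub> l) x) = x" if "x \<in> carrier A" for x
        using l that mult[of "inv\<^bsub>L\<^esub> l" l x] mult[of l "inv\<^bsub>L\<^esub> l" x] one by simp_all
    qed
    then show ?thesis using ext[OF l] by (simp add: Bij_def)
  qed
  \<comment> \<open>\<open>BijGroup\<close> multiplies by \<open>compose\<close>, whose values off
    the carrier are undefined. Equality of functions thus needs the hypothesis \<open>ext\<close>,
    and the actions constructed below are restricted functions.\<close>
  have "\<alpha> (l \<otimes>\<^bsub>L\<^esub> m) = compose (carrier A) (\<alpha> l) (\<alpha> m)" if "l \<in> carrier L" "m \<in> carrier L" for l m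
    using that mult by (intro extensionalityI[OF ext compose_extensional]) (auto simp: compose_def)
  then have "\<alpha> \<in> hom L (alg_Aut A)"
    using bij hom by (auto simp: hom_def alg_Aut_def BijGroup_def)
  then show ?thesis
    using A L continuous_map_discrete_Times[where f = \<alpha>, OF cont] by (simp add: dynamical_system_def)
qed

lemma dynamical_systemD:
  assumes "dynamical_system A L \<alpha>"
  shows "lc_algebra A" "group L"
    and "l \<in> carrier L \<Longrightarrow> \<alpha> l \<in> alg_hom A A"
    and "l \<in> carrier L \<Longrightarrow> continuous_map (topol A) (topol A) (\<alpha> l)"
    and "l \<in> carrier L \<Longrightarrow> m \<in> carrier L \<Longrightarrow> x \<in> carrier A \<Longrightarrow> \<alpha> (l \<otimes>\<^bsub>L\<^esub> m) x = \<alpha> l (\<alpha> m x)"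
    and "x \<in> carrier A \<Longrightarrow> \<alpha> \<one>\<^bsub>L\<^esub> x = x"
proof -
  show A: "lc_algebra A" and L: "group L"
    using assms by (simp_all add: dynamical_system_def)
  interpret L: group L by fact
  have hom: "\<alpha> \<in> hom L (alg_Aut A)"
    and cont: "continuous_map (prod_topology (discrete_topology (carrier L)) (topol A)) (topol A) (\<lambda>(l, a). \<alpha> l a)"
    using assms by (simp_all add: dynamical_system_def)
  show "\<alpha> l \<in> alg_hom A A" if "l \<in> carrier L" for l
    using hom that by (auto simp: hom_def alg_Aut_def)
  have bij: "\<alpha> l \<in> Bij (carrier A)" if "l \<in> carrier L" for l
    using hom that by (auto simp: hom_def alg_Aut_def)
  show "continuous_map (topol A) (topol A) (\<alpha> l)" if "l \<in> carrier L" for l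
  proof -
    have "continuous_map (topol A) (prod_topology (discrete_topology (carrier L)) (topol A)) (\<lambda>x. (l, x))"
      using that by (intro continuous_map_pairedI) auto
    from continuous_map_compose[OF this cont] show ?thesis by (simp add: o_def)
  qed
  show mult: "\<alpha> (l \<otimes>\<^bsub>L\<^esub> m) x = \<alpha> l (\<alpha> m x)"
    if "l \<in> carrier L" "m \<in> carrier L" "x \<in> carrier A" for l m x
    using hom that bij by (auto simp: hom_def alg_Aut_def BijGroup_def compose_def)
  show "\<alpha> \<one>\<^bsub>L\<^esub> x = x" if x: "x \<in> carrier A" for x
  proof -
    have b: "bij_betw (\<alpha> \<one>\<^bsub>L\<^esub>) (carrier A) (carrier A)" using bij[of "\<one>\<^bsub>L\<^esub>"] by (simp add: Bij_def)
    then have "\<alpha> \<one>\<^bsub>L\<^esub> x \<in> carrier A" using x by (rule bij_betwE[THEN bspec])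
    \<comment> \<open>The unit acts as an idempotent map, and an injective idempotent map is the
      identity.\<close>
    moreover have "\<alpha> \<one>\<^bsub>L\<^esub> (\<alpha> \<one>\<^bsub>L\<^esub> x) = \<alpha> \<one>\<^bsub>L\<^esub> x" using mult[of "\<one>\<^bsub>L\<^esub>" "\<one>\<^bsub>L\<^esub>" x] x by simp
    ultimately show ?thesis using b x by (auto simp: bij_betw_def inj_on_def)
  qed
qed

context lc_alg
begin

text \<open>Linearity lets \<open>h\<close> pass through the difference quotients, continuity
  through their limit.\<close>

lemma has_curve_derivative_alg_hom:
  assumes "has_curve_derivative A f d t" "range f \<subseteq> carrier A"
    and h: "h \<in> alg_hom A A" "continuous_map (topol A) (topol A) h"
  shows "has_curve_derivative A (\<lambda>t. h (f t)) (h d) t"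
proof -
  have f: "f t \<in> carrier A" for t using assms by auto
  have diff: "h (x \<ominus> y) = h x \<ominus> h y" if "x \<in> carrier A" "y \<in> carrier A" for x y
    using alg_homD(2)[OF h(1), of x "(-1) \<odot> y"] alg_homD(4)[OF h(1), of y "-1"]
      alg_homD(1)[OF h(1), of y] that
    by (simp add: minus_eq smult_minus_one)
  have "h (c \<odot> (f (t + s) \<ominus> f t)) = c \<odot> (h (f (t + s)) \<ominus> h (f t))" for c s
    using f alg_homD(4)[OF h(1), of "f (t + s) \<ominus> f t" c] by (simp add: diff)
  then show ?thesis
    using continuous_map_limit[OF h(2) assms(1)[unfolded has_curve_derivative_def]]
    by (simp add: has_curve_derivative_def o_def)
qed

lemma continuous_map_smooth_alg_hom:
  assumes h: "h \<in> alg_hom A A" "continuous_map (topol A) (topol A) h"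
  shows "continuous_map (smooth_compact_open_topology A) (smooth_compact_open_topology A) (\<lambda>f. h \<circ> f)"
proof (rule continuous_map_smooth_coinduct)
  let ?\<Phi> = "range (\<lambda>n f t. h ((curve_deriv A ^^ n) f t))"
  show "(\<lambda>f. h \<circ> f) \<in> ?\<Phi>" by (rule range_eqI[of _ _ 0]) (simp add: o_def)
  fix \<phi> assume "\<phi> \<in> ?\<Phi>"
  then obtain n where \<phi>: "\<phi> = (\<lambda>f t. h ((curve_deriv A ^^ n) f t))"
    by blast
  show "continuous_map (prod_topology (smooth_compact_open_topology A) euclideanreal) (topol A)
      (\<lambda>x. \<phi> (fst x) (snd x))"
    unfolding \<phi> using continuous_map_compose[OF continuous_map_smooth_eval h(2)] by (simp add: o_def)
  show "\<exists>\<phi>'\<in>?\<Phi>. \<forall>p\<in>topspace (smooth_compact_open_topology A). \<forall>t.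
      has_curve_derivative A (\<phi> p) (\<phi>' p t) t"
    unfolding \<phi>
  proof (rule bexI[OF _ rangeI[of _ "Suc n"]], intro ballI allI)
    fix f t assume "f \<in> topspace (smooth_compact_open_topology A)"
    then show "has_curve_derivative A (\<lambda>t. h ((curve_deriv A ^^ n) f t)) (h ((curve_deriv A ^^ Suc n) f t)) t"
      by (intro has_curve_derivative_alg_hom[OF smooth_curves_funpow(2) _ h])
        (auto intro: smooth_curves_funpow(3))
  qed
qed

end

lemma dynamical_system_smooth_curve_algebra:
  assumes "dynamical_system A L \<alpha>"
  shows "dynamical_system (smooth_curve_algebra A) L (\<lambda>l. \<lambda>f\<in>smooth_curves A. \<alpha> l \<circ> f)"
proof -
  note ds = dynamical_systemD[OF assms]
  interpret lc_alg A by standard (rule ds)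
  interpret L: group L by (rule ds)
  have closed: "\<alpha> l \<circ> f \<in> smooth_curves A" if "l \<in> carrier L" "f \<in> smooth_curves A" for l f
    using continuous_map_image_subset_topspace[OF continuous_map_smooth_alg_hom[OF ds(3,4)]] that by auto
  show ?thesis
  proof (rule dynamical_systemI[OF lc_algebra_smooth_curve_algebra L.group_axioms])
    fix l assume l: "l \<in> carrier L"
    note h = alg_homD[OF ds(3)[OF l]]
    show "(\<lambda>f\<in>smooth_curves A. \<alpha> l \<circ> f) \<in> extensional (carrier (smooth_curve_algebra A))"
      by (simp add: smooth_curve_algebra_def)
    show "(\<lambda>f\<in>smooth_curves A. \<alpha> l \<circ> f) \<in> alg_hom (smooth_curve_algebra A) (smooth_curve_algebra A)"
      using l h smooth_curves_carrier
      by (auto simp: alg_hom_def ring_hom_def smooth_curve_algebra_def closed[unfolded o_def] o_def fun_eq_iff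
          const_smooth smooth_curves_add smooth_curves_mult smooth_curves_smult)
    have "continuous_map (smooth_compact_open_topology A) (smooth_compact_open_topology A)
        (\<lambda>f\<in>smooth_curves A. \<alpha> l \<circ> f)"
      by (rule continuous_map_eq[OF continuous_map_smooth_alg_hom[OF ds(3)[OF l] ds(4)[OF l]]]) simp
    then show "continuous_map (topol (smooth_curve_algebra A)) (topol (smooth_curve_algebra A))
        (\<lambda>f\<in>smooth_curves A. \<alpha> l \<circ> f)"
      by (simp add: smooth_curve_algebra_def)
  next
    fix l m f assume lm: "l \<in> carrier L" "m \<in> carrier L" and "f \<in> carrier (smooth_curve_algebra A)"
    then have "f \<in> smooth_curves A" by (simp add: smooth_curve_algebra_def)
    with lm show "(\<lambda>f\<in>smooth_curves A. \<alpha> (l \<otimes>\<^bsub>L\<^esub> m) \<circ> f) f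
        = (\<lambda>f\<in>smooth_curves A. \<alpha> l \<circ> f) ((\<lambda>f\<in>smooth_curves A. \<alpha> m \<circ> f) f)"
      by (simp add: closed fun_eq_iff ds(5) smooth_curves_carrier)
  next
    fix f assume "f \<in> carrier (smooth_curve_algebra A)"
    then show "(\<lambda>f\<in>smooth_curves A. \<alpha> \<one>\<^bsub>L\<^esub> \<circ> f) f = f"
      by (simp add: smooth_curve_algebra_def fun_eq_iff ds(6) smooth_curves_carrier)
  qed
qed

context lc_closed_ideal
begin

text \<open>The union over representatives copies the shape of \<open>localized_action\<close>, so
  that the latter becomes the instance for the pointwise action on smooth curves.\<close>

definition quotient_action :: "('g \<Rightarrow> 'a \<Rightarrow> 'a) \<Rightarrow> 'g \<Rightarrow> 'a set \<Rightarrow> 'a set" where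
  "quotient_action \<alpha> l = (\<lambda>Y\<in>carrier Q. \<Union>x\<in>Y. I +> \<alpha> l x)"

lemma quotient_action_coset:
  assumes h: "\<alpha> l \<in> alg_hom A A" and I: "\<alpha> l ` I \<subseteq> I" and x: "x \<in> carrier A"
  shows "quotient_action \<alpha> l (I +> x) = I +> \<alpha> l x"
proof -
  have "(\<Union>y\<in>I +> x. I +> \<alpha> l y) = I +> \<alpha> l x"
  proof (rule UNION_coset[OF x])
    fix y assume y: "y \<in> carrier A" "y \<ominus> x \<in> I"
    have "\<alpha> l (y \<ominus> x) = \<alpha> l y \<ominus> \<alpha> l x"
      using alg_homD(2)[OF h, of y "(-1) \<odot> x"] alg_homD(4)[OF h, of x "-1"]
        alg_homD(1)[OF h, of x] x y
      by (simp add: minus_eq smult_minus_one)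
    moreover have "\<alpha> l (y \<ominus> x) \<in> I" using I y by blast
    ultimately show "I +> \<alpha> l y = I +> \<alpha> l x"
      using alg_homD(1)[OF h] x y by (simp add: coset_eq_iff)
  qed
  then show ?thesis using x by (simp add: quotient_action_def)
qed

lemma dynamical_system_quotient:
  assumes "dynamical_system A L \<alpha>" and I: "\<And>l. l \<in> carrier L \<Longrightarrow> \<alpha> l ` I \<subseteq> I"
  shows "dynamical_system Q L (quotient_action \<alpha>)"
proof -
  note ds = dynamical_systemD[OF assms(1)]
  interpret L: group L by (rule ds)
  have coset: "quotient_action \<alpha> l (I +> x) = I +> \<alpha> l x" if "l \<in> carrier L" "x \<in> carrier A" for l x
    using that by (intro quotient_action_coset ds(3) I)
  have car: "\<alpha> l x \<in> carrier A" if "l \<in> carrier L" "x \<in> carrier A" for l x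
    using alg_homD(1)[OF ds(3)] that by blast
  show ?thesis
  proof (rule dynamical_systemI[OF lc_algebra_quotient L.group_axioms])
    fix l assume l: "l \<in> carrier L"
    note h = alg_homD[OF ds(3)[OF l]]
    show "quotient_action \<alpha> l \<in> extensional (carrier Q)" by (simp add: quotient_action_def)
    show "quotient_action \<alpha> l \<in> alg_hom Q Q"
      unfolding alg_hom_def ring_hom_def carrier_quotient
      using l h by (auto simp: coset quotient_simps quotient_smult car)
    have "quotient_map (topol A) (topol Q) (\<lambda>x. I +> x)"
      by (rule continuous_open_imp_quotient_map[OF continuous_map_coset open_map_coset])
        (simp add: topspace_quotient carrier_quotient)
    moreover have "continuous_map (topol A) (topol Q) (quotient_action \<alpha> l \<circ> (\<lambda>x. I +> x))"
      by (rule continuous_map_eq[OF continuous_map_compose[OF ds(4)[OF l] continuous_map_coset]])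
        (use l in \<open>simp add: coset\<close>)
    ultimately show "continuous_map (topol Q) (topol Q) (quotient_action \<alpha> l)"
      by (rule continuous_compose_quotient_map)
  qed (auto simp: carrier_quotient coset car ds(5,6))
qed

end

section \<open>Localization of trivial bundles\<close>

context lc_alg
begin

lemma ideal_smooth_genideal:
  assumes "a \<in> carrier A"
  shows "ideal (genideal (smooth_curve_algebra A) {\<lambda>t. \<one> \<ominus> complex_of_real t \<odot> a}) (smooth_curve_algebra A)"
proof -
  \<comment> \<open>The generator is first written with the scalar -1, the form covered by the
    closure properties of smooth curves.\<close>
  have "(\<lambda>t. \<one> \<oplus> (-1) \<odot> (complex_of_real t \<odot> a)) \<in> smooth_curves A"
    by (intro smooth_curves_add smooth_curves_smult const_smooth linear_smooth assms one_closed)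
  then have "(\<lambda>t. \<one> \<ominus> complex_of_real t \<odot> a) \<in> smooth_curves A"
    using assms by (simp add: smult_minus_one minus_eq)
  then show ?thesis
    by (intro ring.genideal_ideal ring_smooth_curve_algebra) (simp add: smooth_curve_algebra_def)
qed

lemma lc_closed_ideal_localization:
  assumes "a \<in> carrier A"
  shows "lc_closed_ideal (smooth_curve_algebra A) (localization_ideal A a)"
proof -
  interpret C: lc_alg "smooth_curve_algebra A"
    by standard (rule lc_algebra_smooth_curve_algebra)
  have eq: "localization_ideal A a = topol (smooth_curve_algebra A) closure_of
      genideal (smooth_curve_algebra A) {\<lambda>t. \<one> \<ominus> complex_of_real t \<odot> a}"
    by (simp add: localization_ideal_def smooth_curve_algebra_def)
  show ?thesis
    using C.ideal_closure_of[OF ideal_smooth_genideal[OF assms]]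
    by (intro lc_closed_ideal.intro lc_closed_ideal_axioms.intro C.lc_alg_axioms) (simp_all add: eq)
qed

text \<open>Being unital and fixing \<open>a\<close>, the map \<open>h\<close> fixes the generator 1
  - t a for every t. The curves sent into \<open>?J\<close> by composition with \<open>h\<close>
  form an ideal containing that generator, hence all of \<open>?J\<close>; continuity of the
  composition extends the invariance to the closure.\<close>

lemma localization_ideal_invariant:
  assumes a: "a \<in> carrier A" and h: "h \<in> alg_hom A A" "continuous_map (topol A) (topol A) h" "h a = a"
    and f: "f \<in> localization_ideal A a"
  shows "h \<circ> f \<in> localization_ideal A a"
proof -
  let ?C = "smooth_curve_algebra A"
  let ?J = "genideal ?C {\<lambda>t. \<one> \<ominus> complex_of_real t \<odot> a}"
  interpret J: ideal ?J ?C by (rule ideal_smooth_genideal[OF a])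
  note hom = alg_homD[OF h(1)]
  note cont = continuous_map_smooth_alg_hom[OF h(1,2)]
  have C: "carrier ?C = smooth_curves A" by (simp add: smooth_curve_algebra_def)
  have closed: "h \<circ> f \<in> smooth_curves A" if "f \<in> smooth_curves A" for f
    using continuous_map_image_subset_topspace[OF cont] that by auto
  have "(\<lambda>f. h \<circ> f) \<in> ring_hom ?C ?C"
    using smooth_curves_carrier
    by (auto simp: ring_hom_def smooth_curve_algebra_def fun_eq_iff hom closed)
  then interpret H: ring_hom_ring ?C ?C "\<lambda>f. h \<circ> f"
    by (intro ring_hom_ringI2 ring_smooth_curve_algebra)
  have "h (\<one> \<ominus> complex_of_real t \<odot> a) = \<one> \<ominus> complex_of_real t \<odot> a" for t
    using a hom(2)[of \<one> "(-1) \<odot> (complex_of_real t \<odot> a)"] hom(4)[of "complex_of_real t \<odot> a" "-1"]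
    by (simp add: minus_eq smult_minus_one hom h(3))
  then have "(\<lambda>t. \<one> \<ominus> complex_of_real t \<odot> a) \<in> {f \<in> carrier ?C. h \<circ> f \<in> ?J}"
    using J.genideal_self'[of "\<lambda>t. \<one> \<ominus> complex_of_real t \<odot> a"] J.a_Hcarr
    by (force simp: genideal_def o_def)
  moreover have "ideal {f \<in> carrier ?C. h \<circ> f \<in> ?J} ?C"
  proof (rule idealI)
    show "subgroup {f \<in> carrier ?C. h \<circ> f \<in> ?J} (add_monoid ?C)"
    proof (rule J.add.subgroupI)
      show "{f \<in> carrier ?C. h \<circ> f \<in> ?J} \<noteq> {}"
        using H.hom_zero J.zero_closed additive_subgroup.zero_closed[OF J.is_additive_subgroup] by auto
    qed (auto simp: a_inv_def[symmetric])
  qed (auto simp: J.I_l_closed J.I_r_closed ring_smooth_curve_algebra)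
  ultimately have "?J \<subseteq> {f \<in> carrier ?C. h \<circ> f \<in> ?J}"
    by (intro J.genideal_minimal) auto
  then have "(\<lambda>f. h \<circ> f) ` ?J \<subseteq> ?J" by blast
  then show ?thesis
    using f continuous_map_image_closure_subset[OF cont, of ?J]
      closure_of_mono[of "(\<lambda>f. h \<circ> f) ` ?J" ?J "smooth_compact_open_topology A"]
    unfolding localization_ideal_def by blast
qed

end

text \<open>Roots of 1 in the isotypic components are carried over by the classes of constant
  curves. Invariance of \<open>z\<close> is what makes the action descend to the localization; the
  generating set \<open>S\<close> and its characters are kept.\<close>

lemma trivial_nc_principal_bundle_localization:
  fixes A :: "('a, 'b) lc_alg_scheme" (structure)
  assumes triv: "trivial_nc_principal_bundle A L \<alpha>"
    and z: "z \<in> carrier A" and inv_z: "\<And>l. l \<in> carrier L \<Longrightarrow> \<alpha> l z = z"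
  shows "trivial_nc_principal_bundle (smooth_localization A z) L (localized_action A \<alpha> z)"
proof -
  have "dynamical_system A L \<alpha>" using triv by (simp add: trivial_nc_principal_bundle_def)
  note ds = dynamical_systemD[OF this]
  interpret lc_alg A by standard (rule ds)
  let ?C = "smooth_curve_algebra A" and ?I = "localization_ideal A z"
  let ?\<beta> = "\<lambda>l. \<lambda>f\<in>smooth_curves A. \<alpha> l \<circ> f"
  interpret Z: lc_closed_ideal ?C ?I by (rule lc_closed_ideal_localization[OF z])
  have C: "carrier ?C = smooth_curves A" by (simp add: smooth_curve_algebra_def)
  have loc: "smooth_localization A z = Z.Q" by (simp add: smooth_localization_def)
  have dsC: "dynamical_system ?C L ?\<beta>"
    by (rule dynamical_system_smooth_curve_algebra) fact
  have inv: "?\<beta> l ` ?I \<subseteq> ?I" if "l \<in> carrier L" for l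
    using localization_ideal_invariant[OF z ds(3,4) inv_z] that Z.a_Hcarr C by auto
  \<comment> \<open>The two sides differ only in that \<open>?\<beta>\<close> is restricted to
    smooth curves. All representatives of a class are smooth, and off the carrier both sides are
    undefined.\<close>
  have action: "localized_action A \<alpha> z = Z.quotient_action ?\<beta>"
  proof (intro ext)
    fix l Y
    show "localized_action A \<alpha> z l Y = Z.quotient_action ?\<beta> l Y"
    proof (cases "Y \<in> carrier Z.Q")
      case True
      then have "Y \<subseteq> smooth_curves A"
        using Z.a_rcosets_carrier C by (auto simp: quotient_algebra_def FactRing_def)
      then have "(\<Union>f\<in>Y. ?I +>\<^bsub>?C\<^esub> (\<alpha> l \<circ> f)) = (\<Union>f\<in>Y. ?I +>\<^bsub>?C\<^esub> ?\<beta> l f)"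
        by (intro SUP_cong) auto
      with True show ?thesis
        by (simp add: localized_action_def Z.quotient_action_def loc)
    qed (simp add: localized_action_def Z.quotient_action_def loc)
  qed
  \<comment> \<open>The transfer rests on four properties of \<open>j\<close>: it preserves
    products, the unit and scalar multiples, and it intertwines the actions.\<close>
  define j where "j a = ?I +>\<^bsub>?C\<^esub> (\<lambda>_. a)" for a
  have const: "(\<lambda>_. a) \<in> carrier ?C" if "a \<in> carrier A" for a using const_smooth that C by simp
  have j_carrier: "j a \<in> carrier Z.Q" if "a \<in> carrier A" for a
    using that by (simp add: j_def const)
  have const_ops: "(\<lambda>_. a) \<otimes>\<^bsub>?C\<^esub> (\<lambda>_. b) = (\<lambda>_. a \<otimes> b)" "\<one>\<^bsub>?C\<^esub> = (\<lambda>_. \<one>)"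
    "c \<odot>\<^bsub>?C\<^esub> (\<lambda>_. a) = (\<lambda>_. c \<odot> a)" for a b c
    by (simp_all add: smooth_curve_algebra_def)
  have j_mult: "j a \<otimes>\<^bsub>Z.Q\<^esub> j b = j (a \<otimes> b)" if "a \<in> carrier A" "b \<in> carrier A" for a b
    using that by (simp add: j_def Z.quotient_simps const const_ops)
  have j_one: "\<one>\<^bsub>Z.Q\<^esub> = j \<one>"
    by (simp add: j_def Z.quotient_simps const_ops)
  have j_smult: "c \<odot>\<^bsub>Z.Q\<^esub> j a = j (c \<odot> a)" if "a \<in> carrier A" for c a
    using that by (simp add: j_def Z.quotient_smult const const_ops)
  interpret R: ring Z.Q by (rule Z.ring_quotient)
  have j_pow: "j a [^]\<^bsub>Z.Q\<^esub> n = j (a [^] n)" if "a \<in> carrier A" for a and n :: nat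
    using that by (induction n) (simp_all add: j_one j_mult)
  have j_action: "localized_action A \<alpha> z l (j a) = j (\<alpha> l a)" if "l \<in> carrier L" "a \<in> carrier A" for l a
    using Z.quotient_action_coset[of ?\<beta> l "\<lambda>_. a", OF dynamical_systemD(3)[OF dsC that(1)] inv[OF that(1)]]
      const[OF that(2)] C by (simp add: action j_def o_def)
  have j_Units: "j a \<in> Units Z.Q" if "a \<in> Units A" for a
  proof -
    have "inv a \<in> carrier A" "a \<in> carrier A" "inv a \<otimes> a = \<one>" "a \<otimes> inv a = \<one>" using that by auto
    then show ?thesis
      unfolding Units_def by (auto simp: j_mult j_one j_carrier intro!: bexI[of _ "j (inv a)"])
  qed
  obtain S where S: "admissible_generators L S"
    and a: "\<And>s. s \<in> S \<Longrightarrow> \<exists>a\<in>isotypic A L \<alpha> (dual_generator L S s). a \<in> Units A \<and> a [^] group.ord L s = \<one>"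
    using triv unfolding trivial_nc_principal_bundle_def by blast
  have "\<exists>b\<in>isotypic Z.Q L (localized_action A \<alpha> z) (dual_generator L S s).
      b \<in> Units Z.Q \<and> b [^]\<^bsub>Z.Q\<^esub> group.ord L s = \<one>\<^bsub>Z.Q\<^esub>" if s: "s \<in> S" for s
  proof -
    obtain a where "a \<in> isotypic A L \<alpha> (dual_generator L S s)" "a \<in> Units A" "a [^] group.ord L s = \<one>"
      using a[OF s] by blast
    then show ?thesis
      by (intro bexI[of _ "j a"]) (auto simp: isotypic_def j_Units j_pow j_one j_carrier j_action j_smult)
  qed
  moreover have "dynamical_system Z.Q L (localized_action A \<alpha> z)"
    unfolding action by (rule Z.dynamical_system_quotient[OF dsC inv])
  ultimately show ?thesis
    unfolding trivial_nc_principal_bundle_def loc using S by blast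
qed

theorem theorem5p5:
  fixes A :: "'a lc_alg" and L :: "'g monoid" and \<alpha> :: "'g \<Rightarrow> 'a \<Rightarrow> 'a"
  assumes "comm_group L" and "finite (carrier L)"
    and "trivial_nc_principal_bundle A L \<alpha>"
  shows "nc_principal_bundle A L \<alpha>"
  unfolding nc_principal_bundle_def
proof (intro conjI ballI)
  show D: "dynamical_system A L \<alpha>"
    using assms(3) by (simp add: trivial_nc_principal_bundle_def)
  note ds = dynamical_systemD[OF D]
  interpret lc_alg A by standard (rule ds)
  have fixes_one: "\<alpha> l \<one>\<^bsub>A\<^esub> = \<one>\<^bsub>A\<^esub>" if "l \<in> carrier L" for l
    using alg_homD(5)[OF ds(3)[OF that]] .
  let ?Z = "fixed_center A L \<alpha>"
  have Z: "carrier ?Z \<subseteq> carrier A" "monoid.mult ?Z = monoid.mult A"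
    by (auto simp: fixed_center_def center_of_def Let_def)
  have one: "\<one>\<^bsub>A\<^esub> \<in> carrier ?Z"
    by (auto simp: fixed_center_def center_of_def Let_def fixes_one)
  fix \<psi> assume \<psi>: "\<psi> \<in> spectrum_of ?Z"
  then obtain x where x: "x \<in> carrier ?Z" "\<psi> x \<noteq> 0" unfolding spectrum_of_def by blast
  \<comment> \<open>\<open>spectrum_of\<close> does not state that characters are unital. A value
    \<psi> x that is nonzero and factors through \<psi> at the unit excludes that the latter
    vanishes.\<close>
  have "\<psi> (\<one>\<^bsub>A\<^esub> \<otimes>\<^bsub>?Z\<^esub> x) = \<psi> \<one>\<^bsub>A\<^esub> * \<psi> x" using \<psi> one x(1) unfolding spectrum_of_def by blast
  moreover have "\<one>\<^bsub>A\<^esub> \<otimes>\<^bsub>?Z\<^esub> x = x" using Z x(1) by auto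
  ultimately have "\<psi> \<one>\<^bsub>A\<^esub> \<noteq> 0" using x(2) by auto
  with one show "\<exists>z\<in>carrier ?Z. \<psi> z \<noteq> 0 \<and>
      trivial_nc_principal_bundle (smooth_localization A z) L (localized_action A \<alpha> z)"
    using trivial_nc_principal_bundle_localization[OF assms(3) one_closed fixes_one] by blast
qed

end
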